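(* Let $\Sigma$ be a closed connected orientable surface. For any $\epsilon>0$ there exist a magnetic Lagrangian $L_\epsilon:T\Sigma\to\mathbb R$, with $c_u(L_\epsilon)\in[\frac12-\epsilon,\frac12]$, and points $q_0\neq q_1\in\Sigma$ such that, for all $k<\frac12-\epsilon$, the energy level $E^{-1}(k)$ carries no Euler-Lagrange orbits joining $q_0$ to $q_1$.
   Context: A magnetic Lagrangian on $\Sigma$ is a function $L(q,v)=\frac12\|v\|_q^2+\theta_q(v)$, where $\|\cdot\|$ is the norm of a Riemannian metric on $\Sigma$ and $\theta$ is a smooth 1-form on $\Sigma$. Its energy is $E(q,v)=\frac12\|v\|_q^2$. The Mañé critical value of the universal cover is $$c_u(L)=\inf\Big\{k\in\mathbb R\ \Big|\ \int_0^T[L(\gamma,\dot\gamma)+k]\,dt\ge0\ \text{ for every closed contractible loop }\gamma:[0,T]\to\Sigma,\ T>0\Big\}.$$ The level $E^{-1}(k)$ carries an Euler-Lagrange orbit joining $q_0$ to $q_1$ if there is a solution $\gamma:[0,T]\to\Sigma$ of the Euler-Lagrange equation of $L$ with $\gamma(0)=q_0$, $\gamma(T)=q_1$ and $E(\gamma,\dot\gamma)\equiv k$. *)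

theory Defs
  imports "HOL-Analysis.Analysis"
begin

section \<open>Smooth maps between Euclidean spaces\<close>

text \<open>Only used for open \<open>S\<close>. In finite dimension, \<open>f\<close> is \<open>C\<^sup>n\<^sup>+\<^sup>1\<close> iff it is differentiable and all its
  directional derivatives are \<open>C\<^sup>n\<close>.\<close>

primrec Ck_on :: "nat \<Rightarrow> ('a::euclidean_space \<Rightarrow> 'b::euclidean_space) \<Rightarrow> 'a set \<Rightarrow> bool" where
  "Ck_on 0 = (\<lambda>f S. continuous_on S f)"
| "Ck_on (Suc n) = (\<lambda>f S. (\<forall>x\<in>S. f differentiable (at x)) \<and>
     (\<forall>v. Ck_on n (\<lambda>x. frechet_derivative f (at x) v) S))"

definition smooth_on :: "('a::euclidean_space \<Rightarrow> 'b::euclidean_space) \<Rightarrow> 'a set \<Rightarrow> bool" where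
  "smooth_on f S \<longleftrightarrow> (\<forall>n. Ck_on n f S)"


section \<open>Smooth surfaces\<close>

text \<open>A chart \<open>(U, \<phi>)\<close> consists of its domain and its coordinate map; the values of \<open>\<phi>\<close>
  outside \<open>U\<close> carry no information.\<close>

type_synonym 'a chart = "'a set \<times> ('a \<Rightarrow> real^2)"

definition chart_inv :: "'a chart \<Rightarrow> real^2 \<Rightarrow> 'a" where
  "chart_inv c = inv_into (fst c) (snd c)"

definition chart_on :: "'a::topological_space set \<Rightarrow> 'a chart \<Rightarrow> bool" where
  "chart_on M c \<longleftrightarrow> openin (top_of_set M) (fst c) \<and> open (snd c ` fst c) \<and>
     homeomorphism (fst c) (snd c ` fst c) (snd c) (chart_inv c)"

definition transition :: "'a chart \<Rightarrow> 'a chart \<Rightarrow> real^2 \<Rightarrow> real^2" where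
  "transition c d = snd d \<circ> chart_inv c"

definition transition_deriv :: "'a chart \<Rightarrow> 'a chart \<Rightarrow> 'a \<Rightarrow> real^2 \<Rightarrow> real^2" where
  "transition_deriv c d q = frechet_derivative (transition c d) (at (snd c q))"

definition smooth_atlas :: "'a::topological_space set \<Rightarrow> 'a chart set \<Rightarrow> bool" where
  "smooth_atlas M A \<longleftrightarrow> (\<forall>c\<in>A. chart_on M c) \<and> (\<Union>c\<in>A. fst c) = M \<and>
     (\<forall>c\<in>A. \<forall>d\<in>A. smooth_on (transition c d) (snd c ` (fst c \<inter> fst d)))"

text \<open>The surface is \<open>M\<close> with the subspace topology of the ambient Hausdorff type, and with the smooth
  structure generated by the atlas \<open>A\<close>, which need not be maximal. Second countability follows
  from compactness.\<close>

definition closed_connected_surface :: "'a::t2_space set \<Rightarrow> 'a chart set \<Rightarrow> bool" where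
  "closed_connected_surface M A \<longleftrightarrow> smooth_atlas M A \<and> compact M \<and> connected M \<and> M \<noteq> {}"

text \<open>As \<open>A\<close> need not be maximal, the oriented atlas \<open>B\<close> is taken from all charts compatible with \<open>A\<close>.\<close>

definition orientable :: "'a::topological_space set \<Rightarrow> 'a chart set \<Rightarrow> bool" where
  "orientable M A \<longleftrightarrow> (\<exists>B. smooth_atlas M B \<and> smooth_atlas M (A \<union> B) \<and>
     (\<forall>c\<in>B. \<forall>d\<in>B. \<forall>q\<in>fst c \<inter> fst d. det (matrix (transition_deriv c d q)) > 0))"


section \<open>Tangent vectors\<close>

text \<open>A tangent vector at \<open>q\<close> is the family of its components in the charts of \<open>A\<close> around \<open>q\<close>,
  related by the Jacobians of the transition maps, and \<open>0\<close> for all other charts.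
  The vector space operations are pointwise.\<close>

type_synonym 'a tvec = "'a chart \<Rightarrow> real^2"

definition tangent_space :: "'a chart set \<Rightarrow> 'a \<Rightarrow> 'a tvec set" where
  "tangent_space A q = {v.
     (\<forall>c\<in>A. \<forall>d\<in>A. q \<in> fst c \<inter> fst d \<longrightarrow> v d = transition_deriv c d q (v c)) \<and>
     (\<forall>c. \<not> (c \<in> A \<and> q \<in> fst c) \<longrightarrow> v c = 0)}"

text \<open>The tangent vector at \<open>q\<close> with component \<open>u\<close> in the chart \<open>c\<close>; for \<open>u = axis i 1\<close> it is the
  coordinate vector \<open>\<partial>\<^sub>i\<close> of \<open>c\<close>.\<close>

definition tangent_of :: "'a chart set \<Rightarrow> 'a chart \<Rightarrow> 'a \<Rightarrow> real^2 \<Rightarrow> 'a tvec" where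
  "tangent_of A c q u = (\<lambda>d. if d \<in> A \<and> q \<in> fst d then transition_deriv c d q u else 0)"

definition riemannian_metric ::
  "'a set \<Rightarrow> 'a chart set \<Rightarrow> ('a \<Rightarrow> 'a tvec \<Rightarrow> 'a tvec \<Rightarrow> real) \<Rightarrow> bool" where
  "riemannian_metric M A g \<longleftrightarrow>
     (\<forall>q\<in>M. \<forall>v\<in>tangent_space A q. \<forall>w\<in>tangent_space A q.
        g q v w = g q w v \<and>
        (\<forall>z\<in>tangent_space A q. \<forall>a. g q (\<lambda>c. a *\<^sub>R v c + w c) z = a * g q v z + g q w z)) \<and>
     (\<forall>q\<in>M. \<forall>v\<in>tangent_space A q. v \<noteq> (\<lambda>c. 0) \<longrightarrow> g q v v > 0) \<and>
     (\<forall>c\<in>A. \<forall>i j. smooth_on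
        (\<lambda>x. g (chart_inv c x) (tangent_of A c (chart_inv c x) (axis i 1))
                               (tangent_of A c (chart_inv c x) (axis j 1)))
        (snd c ` fst c))"

definition smooth_one_form :: "'a set \<Rightarrow> 'a chart set \<Rightarrow> ('a \<Rightarrow> 'a tvec \<Rightarrow> real) \<Rightarrow> bool" where
  "smooth_one_form M A \<theta> \<longleftrightarrow>
     (\<forall>q\<in>M. \<forall>v\<in>tangent_space A q. \<forall>w\<in>tangent_space A q. \<forall>a.
        \<theta> q (\<lambda>c. a *\<^sub>R v c + w c) = a * \<theta> q v + \<theta> q w) \<and>
     (\<forall>c\<in>A. \<forall>i. smooth_on
        (\<lambda>x. \<theta> (chart_inv c x) (tangent_of A c (chart_inv c x) (axis i 1))) (snd c ` fst c))"


section \<open>Magnetic Lagrangians\<close>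

definition metric_norm :: "('a \<Rightarrow> 'a tvec \<Rightarrow> 'a tvec \<Rightarrow> real) \<Rightarrow> 'a \<Rightarrow> 'a tvec \<Rightarrow> real" where
  "metric_norm g q v = sqrt (g q v v)"

definition magnetic_lagrangian ::
  "('a \<Rightarrow> 'a tvec \<Rightarrow> 'a tvec \<Rightarrow> real) \<Rightarrow> ('a \<Rightarrow> 'a tvec \<Rightarrow> real) \<Rightarrow> 'a \<Rightarrow> 'a tvec \<Rightarrow> real" where
  "magnetic_lagrangian g \<theta> q v = (1/2) * (metric_norm g q v)^2 + \<theta> q v"

definition energy :: "('a \<Rightarrow> 'a tvec \<Rightarrow> 'a tvec \<Rightarrow> real) \<Rightarrow> 'a \<Rightarrow> 'a tvec \<Rightarrow> real" where
  "energy g q v = (1/2) * (metric_norm g q v)^2"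


section \<open>Curves\<close>

text \<open>Derivatives are taken within the parameter interval \<open>I\<close>, hence one-sided at its endpoints.\<close>

definition velocity :: "'a chart set \<Rightarrow> real set \<Rightarrow> (real \<Rightarrow> 'a) \<Rightarrow> real \<Rightarrow> 'a tvec" where
  "velocity A I \<gamma> t = (\<lambda>c. if c \<in> A \<and> \<gamma> t \<in> fst c
     then vector_derivative (snd c \<circ> \<gamma>) (at t within I) else 0)"

definition C1_curve ::
  "'a::topological_space set \<Rightarrow> 'a chart set \<Rightarrow> real set \<Rightarrow> (real \<Rightarrow> 'a) \<Rightarrow> bool" where
  "C1_curve M A I \<gamma> \<longleftrightarrow> continuous_on I \<gamma> \<and> \<gamma> ` I \<subseteq> M \<and>
     (\<forall>c\<in>A. (\<forall>t\<in>I. \<gamma> t \<in> fst c \<longrightarrow> (snd c \<circ> \<gamma>) differentiable (at t within I)) \<and>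
        continuous_on {t\<in>I. \<gamma> t \<in> fst c} (\<lambda>t. vector_derivative (snd c \<circ> \<gamma>) (at t within I)))"

text \<open>Unlike \<^const>\<open>piecewise_C1_differentiable_on\<close>, this requires one-sided velocities to exist at the
  break points, so that the action integrand is bounded and piecewise continuous.\<close>

definition piecewise_C1_curve ::
  "'a::topological_space set \<Rightarrow> 'a chart set \<Rightarrow> real \<Rightarrow> (real \<Rightarrow> 'a) \<Rightarrow> bool" where
  "piecewise_C1_curve M A T \<gamma> \<longleftrightarrow> (\<exists>n s. s 0 = 0 \<and> s n = T \<and>
     (\<forall>i<n. s i < s (Suc i) \<and> C1_curve M A {s i..s (Suc i)} \<gamma>))"

definition closed_contractible_loop ::
  "'a::topological_space set \<Rightarrow> 'a chart set \<Rightarrow> real \<Rightarrow> (real \<Rightarrow> 'a) \<Rightarrow> bool" where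
  "closed_contractible_loop M A T \<gamma> \<longleftrightarrow> piecewise_C1_curve M A T \<gamma> \<and> \<gamma> 0 = \<gamma> T \<and>
     (\<exists>a\<in>M. homotopic_loops M (\<lambda>s. \<gamma> (T * s)) (\<lambda>s. a))"

text \<open>For a magnetic Lagrangian on a nonempty compact surface the infimum is that of a nonempty set bounded
  below by \<open>0\<close> (constant loops have action \<open>k * T\<close>), so it can be taken in the reals.\<close>

definition mane_critical_value ::
  "'a::topological_space set \<Rightarrow> 'a chart set \<Rightarrow> ('a \<Rightarrow> 'a tvec \<Rightarrow> real) \<Rightarrow> real" where
  "mane_critical_value M A L = Inf {k. \<forall>T>0. \<forall>\<gamma>. closed_contractible_loop M A T \<gamma> \<longrightarrow>
     integral {0..T} (\<lambda>t. L (\<gamma> t) (velocity A {0..T} \<gamma> t) + k) \<ge> 0}"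

definition local_lagrangian ::
  "'a chart set \<Rightarrow> ('a \<Rightarrow> 'a tvec \<Rightarrow> real) \<Rightarrow> 'a chart \<Rightarrow> real^2 \<Rightarrow> real^2 \<Rightarrow> real" where
  "local_lagrangian A L c x u = L (chart_inv c x) (tangent_of A c (chart_inv c x) u)"

text \<open>In every chart, with \<open>x = \<phi> \<circ> \<gamma>\<close> and \<open>u = x'\<close>, the Euler-Lagrange equation
  \<open>d/dt (\<partial>L/\<partial>u) = \<partial>L/\<partial>x\<close> as an identity of covectors, that is, evaluated on each \<open>w\<close>. For a
  magnetic Lagrangian, which is fibrewise strictly convex, \<open>C\<^sup>1\<close> solutions in this sense are
  automatically smooth.\<close>

definition EL_solution ::
  "'a::topological_space set \<Rightarrow> 'a chart set \<Rightarrow> ('a \<Rightarrow> 'a tvec \<Rightarrow> real) \<Rightarrow> real \<Rightarrow> (real \<Rightarrow> 'a) \<Rightarrow> bool"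
  where
  "EL_solution M A L T \<gamma> \<longleftrightarrow> C1_curve M A {0..T} \<gamma> \<and>
     (\<forall>c\<in>A. \<forall>t\<in>{0..T}. \<gamma> t \<in> fst c \<longrightarrow>
        (let x = snd c \<circ> \<gamma>;
             u = (\<lambda>s. velocity A {0..T} \<gamma> s c)
         in \<forall>w. ((\<lambda>s. frechet_derivative (\<lambda>y. local_lagrangian A L c (x s) y) (at (u s)) w)
                 has_real_derivative
                 frechet_derivative (\<lambda>y. local_lagrangian A L c y (u t)) (at (x t)) w)
                (at t within {0..T})))"

definition carries_EL_orbit ::
  "'a::topological_space set \<Rightarrow> 'a chart set \<Rightarrow> ('a \<Rightarrow> 'a tvec \<Rightarrow> real) \<Rightarrow> ('a \<Rightarrow> 'a tvec \<Rightarrow> real) \<Rightarrow>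
     real \<Rightarrow> 'a \<Rightarrow> 'a \<Rightarrow> bool" where
  "carries_EL_orbit M A L E k q0 q1 \<longleftrightarrow> (\<exists>T>0. \<exists>\<gamma>. EL_solution M A L T \<gamma> \<and>
     \<gamma> 0 = q0 \<and> \<gamma> T = q1 \<and> (\<forall>t\<in>{0..T}. E (\<gamma> t) (velocity A {0..T} \<gamma> t) = k))"

end

theory Submission
  imports Defs
begin

text \<open>The point \<open>q0\<close> is the centre of a coordinate disc, and everything is arranged to be rotationally
  symmetric about it. Near \<open>q0\<close> the metric is the Euclidean metric of the coordinates times a positive
  radial function, and \<open>\<theta>\<close> is a radial function times the angular form \<open>y\<^sub>1 dy\<^sub>2 - y\<^sub>2 dy\<^sub>1\<close>, supported in a
  smaller disc. The form is scaled so that its pointwise norm has maximum one, attained on a circle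
  around \<open>q0\<close>; the point \<open>q1\<close> is any point of this circle.

  The critical value is exactly \<open>1/2\<close> (lemma \<open>mane_critical_value_eq_half\<close>). Indeed \<open>\<bar>\<theta> v\<bar> \<le> \<parallel>v\<parallel>\<close> gives
  \<open>L + 1/2 \<ge> (\<parallel>v\<parallel> - 1)\<^sup>2 / 2\<close>, and equality holds along the circle when it is run at unit speed against the
  form; this loop is contractible inside the disc.

  The circle is also a barrier (lemma \<open>orbit_from_centre_energy\<close>). Rotational symmetry yields a conserved
  angular momentum. It is zero along orbits that start at the centre, so the angular part of the metric
  velocity balances the form. On the circle, where the form has norm one, this forces speed at least
  one and hence energy at least \<open>1/2\<close>. Orbits from \<open>q0\<close> of smaller energy never reach the circle.

  The metric is a sum of Euclidean metrics of finitely many charts, each weighted by a bump function built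
  from \<open>exp (-1/t)\<close>; only one of these bumps meets the disc that carries the form
  (lemma \<open>exists_bump_cover\<close>).\<close>

section \<open>Calculus of smooth maps\<close>

lemma Ck_on_cong:
  assumes "open S" "\<And>x. x \<in> S \<Longrightarrow> f x = g x" "Ck_on n f S"
  shows "Ck_on n g S"
  using assms(2,3)
proof (induction n arbitrary: f g)
  case 0
  then show ?case using continuous_on_eq by auto
next
  case (Suc n)
  have D: "(g has_derivative frechet_derivative f (at x)) (at x)" if "x \<in> S" for x
    using that Suc.prems assms(1) frechet_derivative_works
    by (intro has_derivative_transform_within_open[of f _ x UNIV S g]) auto
  have fd: "frechet_derivative g (at x) = frechet_derivative f (at x)" if "x \<in> S" for x
    using frechet_derivative_at[OF D[OF that]] by simp
  have "Ck_on n (\<lambda>x. frechet_derivative g (at x) v) S" for v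
  proof (rule Suc.IH)
    show "Ck_on n (\<lambda>x. frechet_derivative f (at x) v) S"
      using Suc.prems(2) by simp
  qed (simp add: fd)
  with D show ?case by (auto simp: differentiable_def)
qed

lemma Ck_on_Suc_has_derivative:
  "Ck_on (Suc n) f S \<Longrightarrow> x \<in> S \<Longrightarrow> (f has_derivative frechet_derivative f (at x)) (at x)"
  by (metis Ck_on.simps(2) frechet_derivative_works)

text \<open>Any formula for the derivative may be used in place of \<^const>\<open>frechet_derivative\<close>. The closure
  properties below are all proved by induction on \<open>n\<close>: the derivative of the map in question is
  again built by such operations, from \<open>C\<^sup>n\<close> maps.\<close>

lemma Ck_on_SucI:
  assumes "open S" "\<And>x. x \<in> S \<Longrightarrow> (f has_derivative f' x) (at x)"
    "\<And>v. Ck_on n (\<lambda>x. f' x v) S"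
  shows "Ck_on (Suc n) f S"
proof -
  have "f' x = frechet_derivative f (at x)" if "x \<in> S" for x
    using frechet_derivative_at[OF assms(2)[OF that]] by simp
  then have "Ck_on n (\<lambda>x. frechet_derivative f (at x) v) S" for v
    by (intro Ck_on_cong[OF assms(1) _ assms(3)[of v], of "\<lambda>x. frechet_derivative f (at x) v"]) simp
  with assms(2) show ?thesis by (auto simp: differentiable_def)
qed

lemma Ck_on_SucD: "Ck_on (Suc n) f S \<Longrightarrow> Ck_on n f S"
proof (induction n arbitrary: f)
  case 0
  then show ?case
    by (auto intro!: continuous_at_imp_continuous_on differentiable_imp_continuous_within)
next
  case (Suc n)
  from Suc.prems have "Ck_on n (\<lambda>x. frechet_derivative f (at x) v) S" for v
    by (intro Suc.IH) simp
  with Suc.prems show ?case by simp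
qed

lemma Ck_on_Un: "open S \<Longrightarrow> open T \<Longrightarrow> Ck_on n f S \<Longrightarrow> Ck_on n f T \<Longrightarrow> Ck_on n f (S \<union> T)"
proof (induction n arbitrary: f)
  case 0
  then show ?case by (simp add: continuous_on_open_Un)
next
  case (Suc n)
  have "Ck_on n (\<lambda>x. frechet_derivative f (at x) v) (S \<union> T)" for v
    using Suc by simp
  with Suc.prems show ?case by auto
qed

lemma Ck_on_const: "Ck_on n (\<lambda>x. c) S"
  by (induction n arbitrary: c) auto

lemma Ck_on_bounded_linear:
  assumes "bounded_linear L" "open S" "Ck_on n f S"
  shows "Ck_on n (\<lambda>x. L (f x)) S"
  using assms(3)
proof (induction n arbitrary: f)
  case 0
  then show ?case by (simp add: assms(1) bounded_linear.continuous_on)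
next
  case (Suc n)
  show ?case
  proof (rule Ck_on_SucI[OF assms(2)])
    show "((\<lambda>x. L (f x)) has_derivative (\<lambda>v. L (frechet_derivative f (at x) v))) (at x)"
      if "x \<in> S" for x
      by (intro bounded_linear.has_derivative[OF assms(1)] Ck_on_Suc_has_derivative[OF Suc.prems that])
    show "Ck_on n (\<lambda>x. L (frechet_derivative f (at x) v)) S" for v
      using Suc.prems by (intro Suc.IH) auto
  qed
qed

lemma Ck_on_add:
  assumes "open S" "Ck_on n f S" "Ck_on n g S"
  shows "Ck_on n (\<lambda>x. f x + g x) S"
  using assms(2,3)
proof (induction n arbitrary: f g)
  case 0
  then show ?case by (auto intro: continuous_intros)
next
  case (Suc n)
  show ?case
  proof (rule Ck_on_SucI[OF assms(1)])
    show "((\<lambda>x. f x + g x) has_derivative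
        (\<lambda>v. frechet_derivative f (at x) v + frechet_derivative g (at x) v)) (at x)"
      if "x \<in> S" for x
      by (intro has_derivative_add Ck_on_Suc_has_derivative[OF Suc.prems(1) that]
          Ck_on_Suc_has_derivative[OF Suc.prems(2) that])
    show "Ck_on n (\<lambda>x. frechet_derivative f (at x) v + frechet_derivative g (at x) v) S" for v
      using Suc.prems by (intro Suc.IH) auto
  qed
qed

lemma Ck_on_sum:
  assumes "open S" "\<And>i. i \<in> I \<Longrightarrow> Ck_on n (f i) S"
  shows "Ck_on n (\<lambda>x. \<Sum>i\<in>I. f i x) S"
  using assms(2)
  by (induction I rule: infinite_finite_induct) (auto intro: Ck_on_const Ck_on_add[OF assms(1)])

lemma Ck_on_bilinear:
  assumes "bounded_bilinear b" "open S" "Ck_on n f S" "Ck_on n g S"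
  shows "Ck_on n (\<lambda>x. b (f x) (g x)) S"
  using assms(3,4)
proof (induction n arbitrary: f g)
  case 0
  then show ?case by (simp add: assms(1) bounded_bilinear.continuous_on)
next
  case (Suc n)
  show ?case
  proof (rule Ck_on_SucI[OF assms(2)])
    show "((\<lambda>x. b (f x) (g x)) has_derivative
        (\<lambda>v. b (f x) (frechet_derivative g (at x) v) + b (frechet_derivative f (at x) v) (g x)))
        (at x)"
      if "x \<in> S" for x
      by (intro bounded_bilinear.FDERIV[OF assms(1)] Ck_on_Suc_has_derivative[OF Suc.prems(1) that]
          Ck_on_Suc_has_derivative[OF Suc.prems(2) that])
    show "Ck_on n (\<lambda>x. b (f x) (frechet_derivative g (at x) v)
        + b (frechet_derivative f (at x) v) (g x)) S" for v
      using Suc.prems Ck_on_SucD[OF Suc.prems(1)] Ck_on_SucD[OF Suc.prems(2)]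
      by (intro Ck_on_add assms(2) Suc.IH) auto
  qed
qed

text \<open>The chain rule writes \<open>D(f \<circ> g)(x) v\<close> as \<open>Df(g x)\<close> applied to a vector that depends on \<open>x\<close>,
  whereas the induction hypothesis speaks of \<open>Df(g x)\<close> at fixed vectors; expanding \<open>Dg(x) v\<close> in the
  basis reduces the one to the other.\<close>

lemma Ck_on_compose:
  fixes f :: "'b::euclidean_space \<Rightarrow> 'c::euclidean_space"
    and g :: "'a::euclidean_space \<Rightarrow> 'b"
  assumes "open S" "open T" "g ` S \<subseteq> T" "Ck_on n g S" "Ck_on n f T"
  shows "Ck_on n (\<lambda>x. f (g x)) S"
  using assms(4,5)
proof (induction n arbitrary: f)
  case 0
  then show ?case using continuous_on_compose2[of T f S g] assms(3) by auto
next
  case (Suc n)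
  let ?Df = "\<lambda>y. frechet_derivative f (at y)" and ?Dg = "\<lambda>x. frechet_derivative g (at x)"
  have f: "(f has_derivative ?Df y) (at y)" if "y \<in> T" for y
    using Ck_on_Suc_has_derivative[OF Suc.prems(2) that] .
  show ?case
  proof (rule Ck_on_SucI[OF assms(1)])
    fix x assume x: "x \<in> S"
    have "((\<lambda>x. f (g x)) has_derivative (\<lambda>v. ?Df (g x) (?Dg x v))) (at x)"
      using x assms(3) by (intro has_derivative_compose[of g _ x UNIV f]
        Ck_on_Suc_has_derivative[OF Suc.prems(1)] f) auto
    moreover have "?Df (g x) (?Dg x v) = (\<Sum>b\<in>Basis. (?Dg x v \<bullet> b) *\<^sub>R ?Df (g x) b)" for v
    proof -
      have lin: "linear (?Df (g x))"
        using f x assms(3) has_derivative_linear by blast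
      have "?Df (g x) (?Dg x v) = ?Df (g x) (\<Sum>b\<in>Basis. (?Dg x v \<bullet> b) *\<^sub>R b)"
        by (simp add: euclidean_representation)
      then show ?thesis by (simp add: linear_sum[OF lin] linear_cmul[OF lin])
    qed
    ultimately show "((\<lambda>x. f (g x)) has_derivative
        (\<lambda>v. \<Sum>b\<in>Basis. (?Dg x v \<bullet> b) *\<^sub>R ?Df (g x) b)) (at x)"
      by simp
  next
    fix v
    show "Ck_on n (\<lambda>x. \<Sum>b\<in>Basis. (?Dg x v \<bullet> b) *\<^sub>R ?Df (g x) b) S"
    proof (intro Ck_on_sum assms(1) Ck_on_bilinear[OF bounded_bilinear_scaleR])
      fix b :: 'b
      show "Ck_on n (\<lambda>x. ?Dg x v \<bullet> b) S"
        using Suc.prems by (intro Ck_on_bounded_linear[OF bounded_linear_inner_left] assms(1)) auto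
      show "Ck_on n (\<lambda>x. ?Df (g x) b) S"
        using Suc.prems(2) Ck_on_SucD[OF Suc.prems(1)] by (intro Suc.IH) auto
    qed
  qed
qed

section \<open>A flat function on the line\<close>

text \<open>Together with the usual \<open>exp (-1/t)\<close> (the case \<open>p = 1\<close>) come all functions \<open>p(1/t) exp (-1/t)\<close>:
  this family is closed under differentiation, so that smoothness of all its members follows by a single
  induction.\<close>

definition flat_exp :: "real poly \<Rightarrow> real \<Rightarrow> real" where
  "flat_exp p t = (if t > 0 then poly p (1 / t) * exp (- 1 / t) else 0)"

lemma tendsto_poly_times_exp_minus:
  "((\<lambda>x::real. poly p x * exp (- x)) \<longlongrightarrow> 0) at_top"
proof -
  have "((\<lambda>x. \<Sum>i\<le>degree p. coeff p i * (x ^ i / exp x)) \<longlongrightarrow> (\<Sum>i\<le>degree p. coeff p i * 0)) at_top"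
    by (intro tendsto_intros tendsto_power_div_exp_0)
  moreover have "poly p x * exp (- x) = (\<Sum>i\<le>degree p. coeff p i * (x ^ i / exp x))" for x
    by (simp add: poly_altdef exp_minus sum_distrib_right divide_inverse mult.assoc)
  ultimately show ?thesis by simp
qed

lemma flat_exp_tendsto_0: "(flat_exp p \<longlongrightarrow> 0) (at 0)"
proof -
  have "((\<lambda>t::real. poly p (inverse t) * exp (- inverse t)) \<longlongrightarrow> 0) (at_right 0)"
    by (rule filterlim_compose[OF tendsto_poly_times_exp_minus filterlim_inverse_at_top_right])
  moreover have "\<forall>\<^sub>F t in at_right 0. poly p (inverse t) * exp (- inverse t) = flat_exp p t"
    by (auto simp: flat_exp_def eventually_at_filter divide_inverse)
  ultimately have "(flat_exp p \<longlongrightarrow> 0) (at_right 0)"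
    by (rule Lim_transform_eventually)
  moreover have "(flat_exp p \<longlongrightarrow> 0) (at_left 0)"
    by (rule tendsto_eventually) (auto simp: flat_exp_def eventually_at_filter)
  ultimately show ?thesis by (simp add: filterlim_split_at)
qed

text \<open>On \<open>t > 0\<close> the product rule produces the factor \<open>(p - p')(1/t) / t\<^sup>2\<close>, which explains the
  polynomial. At \<open>0\<close> the difference quotient \<open>flat_exp p h / h\<close> is again a member of the family, with \<open>p\<close>
  multiplied by the variable, and so tends to \<open>0\<close>.\<close>

lemma flat_exp_deriv:
  "(flat_exp p has_real_derivative flat_exp (monom 1 2 * (p - pderiv p)) t) (at t)"
proof (cases t "0::real" rule: linorder_cases)
  case less
  have "((\<lambda>_. 0) has_real_derivative 0) (at t)" by simp
  then have "(flat_exp p has_real_derivative 0) (at t)"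
    by (rule has_field_derivative_transform_within_open[of _ _ _ "{..<0}"])
      (use less in \<open>auto simp: flat_exp_def\<close>)
  then show ?thesis using less by (simp add: flat_exp_def)
next
  case equal
  have "((\<lambda>h. flat_exp (pCons 0 p) h) \<longlongrightarrow> 0) (at 0)"
    by (rule flat_exp_tendsto_0)
  moreover have "flat_exp (pCons 0 p) h = flat_exp p h / h" for h
    by (simp add: flat_exp_def)
  ultimately show ?thesis using equal by (simp add: DERIV_def) (simp add: flat_exp_def)
next
  case greater
  have "((\<lambda>t. poly p (1 / t) * exp (- 1 / t)) has_real_derivative
      flat_exp (monom 1 2 * (p - pderiv p)) t) (at t)"
    using greater by (auto intro!: derivative_eq_intros
        simp: flat_exp_def poly_monom field_simps power2_eq_square)
  then show ?thesis
    by (rule has_field_derivative_transform_within_open[of _ _ _ "{0<..}"])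
      (use greater in \<open>auto simp: flat_exp_def\<close>)
qed

lemma Ck_on_flat_exp: "Ck_on n (flat_exp p) UNIV"
proof (induction n arbitrary: p)
  case 0
  show ?case using flat_exp_deriv
    by (auto intro!: continuous_at_imp_continuous_on DERIV_isCont)
next
  case (Suc n)
  have "Ck_on n (\<lambda>x. flat_exp (monom 1 2 * (p - pderiv p)) x * v) UNIV" for v
    by (intro Ck_on_bilinear[OF bounded_bilinear_mult] Suc.IH Ck_on_const) auto
  moreover have "(flat_exp p has_derivative (\<lambda>v. flat_exp (monom 1 2 * (p - pderiv p)) x * v)) (at x)" for x
    using flat_exp_deriv has_field_derivative_imp_has_derivative by blast
  ultimately show ?case by (intro Ck_on_SucI) auto
qed

lemma flat_exp_one_pos_iff: "flat_exp 1 t > 0 \<longleftrightarrow> t > 0"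
  by (simp add: flat_exp_def)

lemma flat_exp_one_nonneg: "flat_exp 1 t \<ge> 0"
  by (simp add: flat_exp_def)

lemma flat_exp_nonpos: "t \<le> 0 \<Longrightarrow> flat_exp p t = 0"
  by (simp add: flat_exp_def)

section \<open>Coordinate discs\<close>

lemma chart_onD:
  assumes "chart_on M c"
  shows "fst c \<subseteq> M" "openin (top_of_set M) (fst c)" "open (snd c ` fst c)"
    "continuous_on (fst c) (snd c)" "continuous_on (snd c ` fst c) (chart_inv c)"
    "q \<in> fst c \<Longrightarrow> chart_inv c (snd c q) = q"
    "y \<in> snd c ` fst c \<Longrightarrow> chart_inv c y \<in> fst c"
    "y \<in> snd c ` fst c \<Longrightarrow> snd c (chart_inv c y) = y"
  using assms openin_imp_subset
  by (fastforce simp: chart_on_def homeomorphism_def)+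

lemma open_chart_image:
  assumes "chart_on M c" "openin (top_of_set M) V"
  shows "open (snd c ` (fst c \<inter> V))"
proof -
  have "openin (top_of_set (fst c)) (fst c \<inter> V)"
    using openin_subtopology_Int2[OF assms(2), of "fst c"] chart_onD(1)[OF assms(1)]
    by (simp add: subtopology_subtopology inf.absorb2)
  then have "openin (top_of_set (snd c ` fst c)) (snd c ` (fst c \<inter> V))"
    using assms(1) homeomorphism_imp_open_map unfolding chart_on_def by blast
  then show ?thesis
    using chart_onD(3)[OF assms(1)] openin_open_trans by blast
qed

definition chart_disc :: "'a chart set \<Rightarrow> 'a chart \<Rightarrow> real^2 \<Rightarrow> real \<Rightarrow> bool" where
  "chart_disc A c x r \<longleftrightarrow> c \<in> A \<and> r > 0 \<and> cball x r \<subseteq> snd c ` fst c"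

lemma openin_chart_ball:
  assumes "chart_on M c"
  shows "openin (top_of_set M) {q \<in> fst c. dist (snd c q) x < r}"
proof -
  have "openin (top_of_set (fst c)) (fst c \<inter> snd c -` ball x r)"
    using chart_onD(4)[OF assms] continuous_openin_preimage_gen open_ball by blast
  moreover have "fst c \<inter> snd c -` ball x r = {q \<in> fst c. dist (snd c q) x < r}"
    by (auto simp: dist_commute)
  ultimately show ?thesis
    using chart_onD(2)[OF assms] openin_trans by metis
qed

lemma mem_chart_cball:
  assumes "chart_on M c" "cball x r \<subseteq> snd c ` fst c"
  shows "q \<in> chart_inv c ` cball x r \<longleftrightarrow> q \<in> fst c \<and> dist (snd c q) x \<le> r"
proof
  assume "q \<in> chart_inv c ` cball x r"
  then show "q \<in> fst c \<and> dist (snd c q) x \<le> r"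
    using assms(2) chart_onD(7,8)[OF assms(1)] by (auto simp: dist_commute)
next
  assume "q \<in> fst c \<and> dist (snd c q) x \<le> r"
  then show "q \<in> chart_inv c ` cball x r"
    using chart_onD(6)[OF assms(1)] by (intro image_eqI[of _ _ "snd c q"]) (auto simp: dist_commute)
qed

text \<open>Closedness in the whole surface, not just in the chart, is what allows functions supported in a
  coordinate disc to be extended by zero; it needs the Hausdorff property.\<close>

lemma closed_chart_cball:
  fixes M :: "'a::t2_space set"
  assumes "chart_on M c" "cball x r \<subseteq> snd c ` fst c"
  shows "closed (chart_inv c ` cball x r)"
proof -
  have "continuous_on (cball x r) (chart_inv c)"
    using continuous_on_subset[OF chart_onD(5)[OF assms(1)] assms(2)] .
  then show ?thesis
    by (intro compact_imp_closed compact_continuous_image compact_cball)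
qed

lemma transition_has_derivative:
  assumes "smooth_atlas M A" "c \<in> A" "d \<in> A" "q \<in> fst c \<inter> fst d"
  shows "(transition c d has_derivative transition_deriv c d q) (at (snd c q))"
proof -
  have "Ck_on (Suc 0) (transition c d) (snd c ` (fst c \<inter> fst d))"
    using assms unfolding smooth_atlas_def smooth_on_def by blast
  then show ?thesis
    using assms(4) unfolding transition_deriv_def
    by (intro Ck_on_Suc_has_derivative[of 0 _ "snd c ` (fst c \<inter> fst d)"]) simp_all
qed

lemma transition_deriv_refl:
  assumes "chart_on M c" "q \<in> fst c"
  shows "transition_deriv c c q u = u"
proof -
  have "(transition c c has_derivative (\<lambda>x. x)) (at (snd c q))"
    by (rule has_derivative_transform_within_open[of "\<lambda>x. x" _ _ _ "snd c ` fst c"])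
      (use assms chart_onD[OF assms(1)] in \<open>auto simp: transition_def\<close>)
  from frechet_derivative_at[OF this] show ?thesis
    by (simp add: transition_deriv_def) metis
qed

section \<open>Bumps in coordinate discs\<close>

text \<open>The squared distance is written as an inner product because this is visibly smooth in \<open>snd c q\<close>.\<close>

definition chart_bump :: "'a chart \<Rightarrow> real^2 \<Rightarrow> real \<Rightarrow> 'a \<Rightarrow> real" where
  "chart_bump c x r q = (if q \<in> fst c then flat_exp 1 (r\<^sup>2 - (snd c q - x) \<bullet> (snd c q - x)) else 0)"

lemma chart_bump_nonneg: "chart_bump c x r q \<ge> 0"
  by (simp add: chart_bump_def flat_exp_one_nonneg)

lemma chart_bump_pos_iff:
  assumes "r > 0"
  shows "chart_bump c x r q > 0 \<longleftrightarrow> q \<in> fst c \<and> dist (snd c q) x < r"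
proof -
  have "(norm (snd c q - x))\<^sup>2 < r\<^sup>2 \<longleftrightarrow> norm (snd c q - x) < r"
    using power2_less_imp_less[of "norm (snd c q - x)" r]
      power_strict_mono[of "norm (snd c q - x)" r 2] assms by auto
  then have "r\<^sup>2 - (snd c q - x) \<bullet> (snd c q - x) > 0 \<longleftrightarrow> dist (snd c q) x < r"
    by (simp add: dist_norm dot_square_norm)
  then show ?thesis by (simp add: chart_bump_def flat_exp_one_pos_iff)
qed

text \<open>A bump lives in the chart \<open>c\<close> and is read here in another chart \<open>d\<close>. The domain of \<open>d\<close> is the union
  of two open sets: on the overlap with \<open>c\<close> the bump is an expression in the transition map, and off
  the closed disc it vanishes.\<close>

lemma smooth_on_bump_times:
  fixes M :: "'a::t2_space set" and G :: "real^2 \<Rightarrow> real"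
  assumes A: "smooth_atlas M A" and disc: "chart_disc A c x r" and d: "d \<in> A"
    and G: "smooth_on G (snd d ` (fst d \<inter> fst c))"
  shows "smooth_on (\<lambda>y. chart_bump c x r (chart_inv d y) * G y) (snd d ` fst d)"
  unfolding smooth_on_def
proof
  fix n
  have cA: "c \<in> A" and r: "r > 0" and cb: "cball x r \<subseteq> snd c ` fst c"
    using disc by (auto simp: chart_disc_def)
  have c: "chart_on M c" and dd: "chart_on M d"
    using A cA d by (auto simp: smooth_atlas_def)
  define K where "K = chart_inv c ` cball x r"
  define S where "S = snd d ` (fst d \<inter> fst c)"
  define S' where "S' = snd d ` (fst d \<inter> (M - K))"
  have "openin (top_of_set M) (M - K)"
    using closed_chart_cball[OF c cb] unfolding K_def[symmetric]
    by (metis Diff_eq openin_open_Int open_Compl)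
  then have S': "open S'" unfolding S'_def by (rule open_chart_image[OF dd])
  have S: "open S" unfolding S_def by (rule open_chart_image[OF dd chart_onD(2)[OF c]])
  have un: "snd d ` fst d = S \<union> S'"
    using chart_onD(1)[OF dd] mem_chart_cball[OF c cb] unfolding S_def S'_def K_def by blast
  have tr: "Ck_on n (transition d c) S"
    using A cA d unfolding smooth_atlas_def smooth_on_def S_def by blast
  have "Ck_on n (\<lambda>y. flat_exp 1 (r\<^sup>2 + (-1) * ((transition d c y + - x) \<bullet> (transition d c y + - x))) * G y) S"
    using G unfolding smooth_on_def S_def[symmetric]
    by (intro Ck_on_bilinear[OF bounded_bilinear_mult] S
        Ck_on_compose[OF S open_UNIV _ _ Ck_on_flat_exp] Ck_on_add Ck_on_const
        Ck_on_bilinear[OF bounded_bilinear_inner] tr) auto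
  then have 1: "Ck_on n (\<lambda>y. chart_bump c x r (chart_inv d y) * G y) S"
    by (rule Ck_on_cong[OF S, rotated])
      (auto simp: S_def chart_bump_def transition_def chart_onD(6)[OF dd])
  have "chart_bump c x r (chart_inv d y) = 0" if "y \<in> S'" for y
  proof -
    obtain q where q: "y = snd d q" "q \<in> fst d" "q \<notin> K"
      using \<open>y \<in> S'\<close> unfolding S'_def by blast
    then have "\<not> chart_bump c x r q > 0"
      using mem_chart_cball[OF c cb] by (auto simp: chart_bump_pos_iff[OF r] K_def)
    then show ?thesis
      using chart_bump_nonneg[of c x r q] q chart_onD(6)[OF dd] by simp
  qed
  then have 2: "Ck_on n (\<lambda>y. chart_bump c x r (chart_inv d y) * G y) S'"
    by (intro Ck_on_cong[OF S' _ Ck_on_const[of n 0]]) auto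
  show "Ck_on n (\<lambda>y. chart_bump c x r (chart_inv d y) * G y) (snd d ` fst d)"
    unfolding un by (rule Ck_on_Un[OF S S' 1 2])
qed

lemma smooth_on_tangent_of:
  assumes A: "smooth_atlas M A" and "c \<in> A" "d \<in> A"
  shows "smooth_on (\<lambda>y. tangent_of A d (chart_inv d y) u c) (snd d ` (fst d \<inter> fst c))"
  unfolding smooth_on_def
proof
  fix n
  have c: "chart_on M c" and d: "chart_on M d"
    using assms by (auto simp: smooth_atlas_def)
  have "Ck_on (Suc n) (transition d c) (snd d ` (fst d \<inter> fst c))"
    using assms unfolding smooth_atlas_def smooth_on_def by blast
  then have "Ck_on n (\<lambda>y. frechet_derivative (transition d c) (at y) u) (snd d ` (fst d \<inter> fst c))"
    by simp
  then show "Ck_on n (\<lambda>y. tangent_of A d (chart_inv d y) u c) (snd d ` (fst d \<inter> fst c))"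
    by (rule Ck_on_cong[rotated 2])
      (use assms open_chart_image[OF d chart_onD(2)[OF c]] chart_onD(6)[OF d] in
        \<open>auto simp: tangent_of_def transition_deriv_def\<close>)
qed

section \<open>Riemannian metrics from bumps\<close>

text \<open>The Euclidean metrics of the charts in \<open>I\<close>, each weighted by a bump. Any nonnegative
  weights will do as long as one of them is positive at each point, since the metrics form a convex cone.\<close>

definition bump_metric ::
  "('a chart \<times> (real^2) \<times> real) set \<Rightarrow> 'a \<Rightarrow> 'a tvec \<Rightarrow> 'a tvec \<Rightarrow> real" where
  "bump_metric I q v w = (\<Sum>(c, x, r)\<in>I. chart_bump c x r q * (v c \<bullet> w c))"

lemma bump_metric_ge:
  assumes "finite I" "(c, x, r) \<in> I"
  shows "chart_bump c x r q * (v c \<bullet> v c) \<le> bump_metric I q v v"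
  using member_le_sum[OF assms(2), of "\<lambda>(c, x, r). chart_bump c x r q * (v c \<bullet> v c)"] assms(1)
  by (auto simp: bump_metric_def chart_bump_nonneg)

text \<open>A nonzero tangent vector has a nonzero component in every chart around its base point, because the
  components determine each other linearly; so the summand of any positive bump is already positive.\<close>

lemma riemannian_bump_metric:
  fixes M :: "'a::t2_space set"
  assumes A: "smooth_atlas M A" and fin: "finite I"
    and disc: "\<And>c x r. (c, x, r) \<in> I \<Longrightarrow> chart_disc A c x r"
    and cover: "\<And>q. q \<in> M \<Longrightarrow> \<exists>(c, x, r)\<in>I. chart_bump c x r q > 0"
  shows "riemannian_metric M A (bump_metric I)"
  unfolding riemannian_metric_def
proof (intro conjI ballI allI impI)
  fix q v w z :: _ and a :: real
  show "bump_metric I q v w = bump_metric I q w v"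
    by (simp add: bump_metric_def inner_commute)
  show "bump_metric I q (\<lambda>c. a *\<^sub>R v c + w c) z = a * bump_metric I q v z + bump_metric I q w z"
    by (simp add: bump_metric_def sum_distrib_left flip: sum.distrib)
      (intro sum.cong, auto simp: inner_add_left algebra_simps)
next
  fix q v assume q: "q \<in> M" and v: "v \<in> tangent_space A q" "v \<noteq> (\<lambda>c. 0)"
  obtain d where "v d \<noteq> 0" using v(2) by blast
  with v(1) have d: "d \<in> A" "q \<in> fst d" "v d \<noteq> 0"
    unfolding tangent_space_def mem_Collect_eq by metis+
  obtain c x r where cI: "(c, x, r) \<in> I" and pos: "chart_bump c x r q > 0"
    using cover[OF q] by auto
  then have c: "c \<in> A" "q \<in> fst c"
    using disc by (auto simp: chart_disc_def chart_bump_def split: if_splits)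
  have "v d = transition_deriv c d q (v c)"
    using v(1) c d unfolding tangent_space_def by blast
  moreover have "linear (transition_deriv c d q)"
    using transition_has_derivative[OF A c(1) d(1)] c d has_derivative_linear by blast
  ultimately have "v c \<noteq> 0" using d(3) linear_0 by metis
  then have "0 < chart_bump c x r q * (v c \<bullet> v c)" using pos by simp
  also have "\<dots> \<le> bump_metric I q v v" by (rule bump_metric_ge[OF fin cI])
  finally show "0 < bump_metric I q v v" .
next
  fix c i j assume "c \<in> A"
  then show "smooth_on (\<lambda>y. bump_metric I (chart_inv c y)
      (tangent_of A c (chart_inv c y) (axis i 1))
      (tangent_of A c (chart_inv c y) (axis j 1))) (snd c ` fst c)"
    unfolding bump_metric_def smooth_on_def case_prod_unfold
  proof (intro allI Ck_on_sum)
    fix n and t assume t: "t \<in> I"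
    obtain d x r where t': "t = (d, x, r)" by (cases t)
    have di: "chart_disc A d x r" using disc t t' by blast
    have sd: "smooth_on (\<lambda>y. tangent_of A c (chart_inv c y) u d) (snd c ` (fst c \<inter> fst d))" for u
      using smooth_on_tangent_of[OF A, of d c u] \<open>c \<in> A\<close> di by (auto simp: chart_disc_def)
    have "open (snd c ` (fst c \<inter> fst d))"
      using A \<open>c \<in> A\<close> di open_chart_image chart_onD(2) unfolding smooth_atlas_def chart_disc_def by metis
    with sd have "smooth_on (\<lambda>y. tangent_of A c (chart_inv c y) (axis i 1) d \<bullet>
        tangent_of A c (chart_inv c y) (axis j 1) d) (snd c ` (fst c \<inter> fst d))"
      unfolding smooth_on_def by (intro allI Ck_on_bilinear[OF bounded_bilinear_inner]) auto
    from smooth_on_bump_times[OF A di \<open>c \<in> A\<close> this]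
    show "Ck_on n (\<lambda>y. chart_bump (fst t) (fst (snd t)) (snd (snd t)) (chart_inv c y) *
        (tangent_of A c (chart_inv c y) (axis i 1) (fst t) \<bullet>
         tangent_of A c (chart_inv c y) (axis j 1) (fst t))) (snd c ` fst c)"
      by (simp add: smooth_on_def t')
  qed (use A in \<open>auto simp: smooth_atlas_def dest: chart_onD(3)\<close>)
qed

section \<open>A rotationally symmetric magnetic form\<close>

text \<open>Multiplication by the imaginary unit, the generator of the rotations about the origin.\<close>

definition rot :: "real^2 \<Rightarrow> real^2" where
  "rot z = (\<chi> i. if i = 1 then - z $ 2 else z $ 1)"

lemma rot_nth [simp]: "rot z $ 1 = - z $ 2" "rot z $ 2 = z $ 1"
  by (simp_all add: rot_def)

lemma inner_real2: "(v::real^2) \<bullet> w = v $ 1 * w $ 1 + v $ 2 * w $ 2"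
  by (simp add: inner_vec_def UNIV_2)

lemma bounded_linear_rot: "bounded_linear rot"
  by (auto intro!: linearI simp: linear_conv_bounded_linear[symmetric] vec_eq_iff forall_2)

lemma inner_rot_rot [simp]: "rot v \<bullet> rot w = v \<bullet> w"
  by (simp add: inner_real2)

text \<open>In the coordinates \<open>(y\<^sub>1, y\<^sub>2)\<close> centred at \<open>x\<close> this is \<open>a\<close> times a radial bump times
  \<open>y\<^sub>1 dy\<^sub>2 - y\<^sub>2 dy\<^sub>1\<close>, that is, a function of the radius times the angular form.\<close>

definition bump_form :: "'a chart \<Rightarrow> real^2 \<Rightarrow> real \<Rightarrow> real \<Rightarrow> 'a \<Rightarrow> 'a tvec \<Rightarrow> real" where
  "bump_form c x r a q v = chart_bump c x r q * (a * (rot (snd c q - x) \<bullet> v c))"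

lemma smooth_bump_form:
  fixes M :: "'a::t2_space set"
  assumes A: "smooth_atlas M A" and disc: "chart_disc A c x r"
  shows "smooth_one_form M A (bump_form c x r a)"
  unfolding smooth_one_form_def
proof (intro conjI ballI allI)
  fix q v w and b :: real
  show "bump_form c x r a q (\<lambda>c. b *\<^sub>R v c + w c) = b * bump_form c x r a q v + bump_form c x r a q w"
    by (simp add: bump_form_def inner_add_right algebra_simps)
next
  fix d i assume d: "d \<in> A"
  have c: "c \<in> A" and cc: "chart_on M c" and dd: "chart_on M d"
    using A d disc by (auto simp: chart_disc_def smooth_atlas_def)
  have op: "open (snd d ` (fst d \<inter> fst c))"
    by (rule open_chart_image[OF dd chart_onD(2)[OF cc]])
  have "smooth_on (\<lambda>y. a * (rot (transition d c y + - x) \<bullet> tangent_of A d (chart_inv d y) (axis i 1) c))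
      (snd d ` (fst d \<inter> fst c))"
    using A c d smooth_on_tangent_of[OF A c d] unfolding smooth_on_def smooth_atlas_def
    by (intro allI Ck_on_bilinear[OF bounded_bilinear_mult] Ck_on_bilinear[OF bounded_bilinear_inner]
        Ck_on_const Ck_on_bounded_linear[OF bounded_linear_rot] Ck_on_add op) auto
  from smooth_on_bump_times[OF A disc d this]
  show "smooth_on (\<lambda>y. bump_form c x r a (chart_inv d y)
      (tangent_of A d (chart_inv d y) (axis i 1))) (snd d ` fst d)"
    by (simp add: bump_form_def transition_def)
qed

section \<open>Choosing the bumps and the strength of the field\<close>

text \<open>The metric has to be rotationally symmetric near the centre of a given coordinate disc, so all
  bumps but the one of this disc must stay away from the smaller concentric disc of radius \<open>\<rho>\<close>. Points of
  the smaller disc are taken care of by the distinguished bump; any other point has a coordinate disc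
  around it that avoids the smaller disc, as this is closed. Compactness leaves finitely many discs.\<close>

lemma exists_bump_cover:
  fixes M :: "'a::t2_space set"
  assumes A: "smooth_atlas M A" and M: "compact M" and disc: "chart_disc A c0 x0 R"
    and \<rho>: "\<rho> < R"
  obtains I where "finite I" "(c0, x0, R) \<in> I" "\<And>c x r. (c, x, r) \<in> I \<Longrightarrow> chart_disc A c x r"
    "\<And>q. q \<in> M \<Longrightarrow> \<exists>(c, x, r)\<in>I. chart_bump c x r q > 0"
    "\<And>c x r q. (c, x, r) \<in> I - {(c0, x0, R)} \<Longrightarrow> q \<in> fst c0 \<Longrightarrow> dist (snd c0 q) x0 \<le> \<rho>
      \<Longrightarrow> chart_bump c x r q = 0"
proof -
  define K where "K = chart_inv c0 ` cball x0 \<rho>"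
  have c0: "chart_on M c0" and cbR: "cball x0 R \<subseteq> snd c0 ` fst c0"
    using A disc by (auto simp: chart_disc_def smooth_atlas_def)
  have cb: "cball x0 \<rho> \<subseteq> snd c0 ` fst c0"
    using cbR \<rho> subset_cball[of \<rho> R x0] by auto
  have K: "q \<in> K \<longleftrightarrow> q \<in> fst c0 \<and> dist (snd c0 q) x0 \<le> \<rho>" for q
    unfolding K_def by (rule mem_chart_cball[OF c0 cb])
  define good where "good = (\<lambda>(c, x, r). chart_disc A c x r \<and>
      ((c, x, r) = (c0, x0, R) \<or> (\<forall>q\<in>K. chart_bump c x r q = 0)))"
  define supp where "supp = (\<lambda>(c :: 'a chart, x, r). {q \<in> fst c. dist (snd c q) x < r})"
  have "\<exists>b. good b \<and> p \<in> supp b" if p: "p \<in> M" for p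
  proof (cases "p \<in> K")
    case True
    then show ?thesis
      using disc \<rho> K by (intro exI[of _ "(c0, x0, R)"]) (auto simp: good_def supp_def)
  next
    case False
    obtain d where d: "d \<in> A" "p \<in> fst d"
      using A p unfolding smooth_atlas_def by blast
    then have dd: "chart_on M d" using A by (simp add: smooth_atlas_def)
    have "openin (top_of_set M) (M - K)"
      using closed_chart_cball[OF c0 cb] unfolding K_def[symmetric]
      by (metis Diff_eq openin_open_Int open_Compl)
    from open_chart_image[OF dd this] have "open (snd d ` (fst d \<inter> (M - K)))" .
    moreover have "snd d p \<in> snd d ` (fst d \<inter> (M - K))" using d p False by auto
    ultimately obtain r where r: "r > 0" "cball (snd d p) r \<subseteq> snd d ` (fst d \<inter> (M - K))"
      using open_contains_cball by meson
    have "chart_bump d (snd d p) r q = 0" if q: "q \<in> K" for q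
    proof (rule ccontr)
      assume "chart_bump d (snd d p) r q \<noteq> 0"
      then have "chart_bump d (snd d p) r q > 0"
        using chart_bump_nonneg[of d "snd d p" r q] by linarith
      then have q': "q \<in> fst d" "snd d q \<in> cball (snd d p) r"
        using chart_bump_pos_iff[OF r(1), of d "snd d p" q] by (simp_all add: dist_commute)
      then obtain q1 where "q1 \<in> fst d" "q1 \<notin> K" "snd d q = snd d q1"
        using r(2) by blast
      then show False using q q' chart_onD(6)[OF dd] by metis
    qed
    moreover have "chart_disc A d (snd d p) r"
      using r d by (auto simp: chart_disc_def)
    ultimately show ?thesis
      using r(1) d by (intro exI[of _ "(d, snd d p, r)"]) (auto simp: good_def supp_def)
  qed
  then obtain b where b: "\<And>p. p \<in> M \<Longrightarrow> good (b p) \<and> p \<in> supp (b p)" by metis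
  have "openin (top_of_set M) (supp (b p))" if "p \<in> M" for p
  proof -
    obtain d y r where bp: "b p = (d, y, r)" by (metis prod_cases3)
    then have "chart_on M d"
      using b[OF that] A by (simp add: good_def chart_disc_def smooth_atlas_def)
    then show ?thesis using openin_chart_ball by (simp add: bp supp_def)
  qed
  moreover have "M \<subseteq> \<Union> ((\<lambda>p. supp (b p)) ` M)" using b by blast
  ultimately have "\<exists>D\<subseteq>(\<lambda>p. supp (b p)) ` M. finite D \<and> M \<subseteq> \<Union> D"
    using M[unfolded compact_eq_openin_cover, rule_format, of "(\<lambda>p. supp (b p)) ` M"] by simp
  then obtain D where D: "D \<subseteq> (\<lambda>p. supp (b p)) ` M" "finite D" "M \<subseteq> \<Union> D"
    by blast
  then obtain N where N: "N \<subseteq> M" "finite N" "D = (\<lambda>p. supp (b p)) ` N"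
    by (meson finite_subset_image)
  define I where "I = insert (c0, x0, R) (b ` N)"
  have "good (c0, x0, R)" using disc by (simp add: good_def)
  then have good: "good t" if "t \<in> I" for t
    using that b N(1) unfolding I_def by blast
  show ?thesis
  proof (rule that)
    show "finite I" "(c0, x0, R) \<in> I" using N(2) by (auto simp: I_def)
    show "chart_disc A c x r" if "(c, x, r) \<in> I" for c x r
      using good[OF that] by (simp add: good_def)
    show "chart_bump c x r q = 0"
      if "(c, x, r) \<in> I - {(c0, x0, R)}" "q \<in> fst c0" "dist (snd c0 q) x0 \<le> \<rho>" for c x r q
      using good[of "(c, x, r)"] that K by (auto simp: good_def)
    show "\<exists>(c, x, r)\<in>I. chart_bump c x r q > 0" if q: "q \<in> M" for q
    proof -
      obtain p where p: "p \<in> N" "q \<in> supp (b p)" using D(3) N(3) q by blast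
      obtain c x r where bp: "b p = (c, x, r)" by (cases "b p")
      have "r > 0" using b[of p] p(1) N(1) bp by (auto simp: good_def chart_disc_def)
      then have "chart_bump c x r q > 0"
        using p(2) bp by (simp add: supp_def chart_bump_pos_iff)
      moreover have "(c, x, r) \<in> I" using p(1) bp by (force simp: I_def)
      ultimately show ?thesis by blast
    qed
  qed
qed

text \<open>The numbers \<open>flat_exp 1 (R\<^sup>2 - s)\<close> and \<open>a * flat_exp 1 (\<rho>\<^sup>2 - s)\<close> are the conformal factor of the metric
  and the coefficient of the form at squared coordinate radius \<open>s\<close>. The squared norm of the form there is
  \<open>(a * flat_exp 1 (\<rho>\<^sup>2 - s))\<^sup>2 * s / flat_exp 1 (R\<^sup>2 - s)\<close>. It attains a positive maximum at some
  \<open>s = r0\<^sup>2\<close>, and \<open>a\<close> is chosen to make this maximum \<open>1\<close>.\<close>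

lemma exists_calibration:
  fixes \<rho> R :: real
  assumes "0 < \<rho>" "\<rho> < R"
  obtains a r0 where "a > 0" "0 < r0" "r0 < \<rho>"
    "\<And>s. s \<ge> 0 \<Longrightarrow> (a * flat_exp 1 (\<rho>\<^sup>2 - s))\<^sup>2 * s \<le> flat_exp 1 (R\<^sup>2 - s)"
    "(a * flat_exp 1 (\<rho>\<^sup>2 - r0\<^sup>2))\<^sup>2 * r0\<^sup>2 = flat_exp 1 (R\<^sup>2 - r0\<^sup>2)"
proof -
  have sq: "\<rho>\<^sup>2 < R\<^sup>2" using assms by (intro power_strict_mono) auto
  define \<Phi> where "\<Phi> s = (flat_exp 1 (\<rho>\<^sup>2 - s))\<^sup>2 * s / flat_exp 1 (R\<^sup>2 - s)" for s
  have Wpos: "flat_exp 1 (R\<^sup>2 - s) > 0" if "s \<le> \<rho>\<^sup>2" for s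
    using that sq by (simp add: flat_exp_one_pos_iff)
  have cont: "continuous_on S (\<lambda>s. flat_exp 1 (b - s))" for S b
    by (rule continuous_on_compose2[of UNIV "flat_exp 1"])
      (use Ck_on_flat_exp[of 0] in \<open>auto intro!: continuous_intros\<close>)
  have "continuous_on {0..\<rho>\<^sup>2} \<Phi>"
    unfolding \<Phi>_def using Wpos by (intro continuous_intros cont) (force simp: less_le)
  then obtain s where s: "s \<in> {0..\<rho>\<^sup>2}" and max: "\<And>t. t \<in> {0..\<rho>\<^sup>2} \<Longrightarrow> \<Phi> t \<le> \<Phi> s"
    using continuous_attains_sup[of "{0..\<rho>\<^sup>2}" \<Phi>] by auto
  have "0 < \<Phi> (\<rho>\<^sup>2 / 2)"
    using assms Wpos[of "\<rho>\<^sup>2 / 2"] by (auto simp: \<Phi>_def flat_exp_one_pos_iff intro!: divide_pos_pos mult_pos_pos zero_less_power)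
  also have "\<dots> \<le> \<Phi> s" using max by simp
  finally have pos: "\<Phi> s > 0" .
  have "s \<noteq> 0" "s \<noteq> \<rho>\<^sup>2" using pos by (auto simp: \<Phi>_def flat_exp_nonpos)
  then have s': "0 < s" "s < \<rho>\<^sup>2" using s by auto
  define a where "a = 1 / sqrt (\<Phi> s)"
  have a: "a > 0" "a\<^sup>2 = 1 / \<Phi> s" using pos by (auto simp: a_def power_divide)
  show ?thesis
  proof (rule that[of a "sqrt s"])
    show "sqrt s < \<rho>" using s' assms real_less_lsqrt by simp
    show "(a * flat_exp 1 (\<rho>\<^sup>2 - (sqrt s)\<^sup>2))\<^sup>2 * (sqrt s)\<^sup>2 = flat_exp 1 (R\<^sup>2 - (sqrt s)\<^sup>2)"
      using pos Wpos[of s] s' by (simp add: power_mult_distrib a(2)) (auto simp: \<Phi>_def)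
    fix t :: real assume t: "t \<ge> 0"
    show "(a * flat_exp 1 (\<rho>\<^sup>2 - t))\<^sup>2 * t \<le> flat_exp 1 (R\<^sup>2 - t)"
    proof (cases "t \<le> \<rho>\<^sup>2")
      case True
      then have "\<Phi> t / \<Phi> s \<le> 1" using max t pos by simp
      then have "\<Phi> t / \<Phi> s * flat_exp 1 (R\<^sup>2 - t) \<le> 1 * flat_exp 1 (R\<^sup>2 - t)"
        by (rule mult_right_mono) (rule flat_exp_one_nonneg)
      moreover have "(a * flat_exp 1 (\<rho>\<^sup>2 - t))\<^sup>2 * t = \<Phi> t / \<Phi> s * flat_exp 1 (R\<^sup>2 - t)"
        using Wpos[OF True] by (simp add: power_mult_distrib a(2)) (simp add: \<Phi>_def[of t])
      ultimately show ?thesis by simp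
    next
      case False
      then show ?thesis using flat_exp_one_nonneg by (simp add: flat_exp_nonpos)
    qed
  qed (use a s' in auto)
qed

section \<open>Curves and coordinate discs\<close>

text \<open>Regularity of a curve has to be checked in every chart of the atlas. In the other charts its
  velocity is the image under the derivative of the transition map, hence again continuous.\<close>

lemma C1_curve_in_chart:
  assumes A: "smooth_atlas M A" and c: "c \<in> A" and T: "T > 0"
    and z: "\<And>t. t \<in> {0..T} \<Longrightarrow> (z has_vector_derivative z' t) (at t within {0..T})"
    and z': "continuous_on {0..T} z'"
    and zc: "\<And>t. t \<in> {0..T} \<Longrightarrow> z t \<in> snd c ` fst c"
  shows "C1_curve M A {0..T} (chart_inv c \<circ> z)"
    and "t \<in> {0..T} \<Longrightarrow> velocity A {0..T} (chart_inv c \<circ> z) t c = z' t"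
proof -
  let ?\<gamma> = "chart_inv c \<circ> z"
  have cc: "chart_on M c" using A c by (simp add: smooth_atlas_def)
  have \<gamma>: "?\<gamma> t \<in> fst c" "snd c (?\<gamma> t) = z t" if "t \<in> {0..T}" for t
    using zc[OF that] chart_onD(7,8)[OF cc] by auto
  have D: "((snd d \<circ> ?\<gamma>) has_vector_derivative transition_deriv c d (?\<gamma> t) (z' t)) (at t within {0..T})"
    if "d \<in> A" "t \<in> {0..T}" "?\<gamma> t \<in> fst d" for d t
  proof -
    have "(transition c d has_derivative transition_deriv c d (?\<gamma> t)) (at (z t) within z ` {0..T})"
      using transition_has_derivative[OF A c that(1), of "?\<gamma> t"] that \<gamma>[OF that(2)]
      by (auto intro: has_derivative_at_withinI)
    from vector_derivative_diff_chain_within[OF z[OF that(2)] this]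
    show ?thesis by (simp add: transition_def comp_def)
  qed
  have V: "vector_derivative (snd d \<circ> ?\<gamma>) (at t within {0..T}) = transition_deriv c d (?\<gamma> t) (z' t)"
    if "d \<in> A" "t \<in> {0..T}" "?\<gamma> t \<in> fst d" for d t
    using vector_derivative_within_closed_interval[OF T that(2) D[OF that]] .
  have zcont: "continuous_on {0..T} z"
    using z by (intro continuous_on_vector_derivative) auto
  show "t \<in> {0..T} \<Longrightarrow> velocity A {0..T} ?\<gamma> t c = z' t"
    using V[OF c] \<gamma> c transition_deriv_refl[OF cc] by (simp add: velocity_def)
  show "C1_curve M A {0..T} ?\<gamma>"
    unfolding C1_curve_def
  proof (intro conjI ballI impI)
    show "continuous_on {0..T} ?\<gamma>"
      unfolding comp_def
      by (rule continuous_on_compose2[OF chart_onD(5)[OF cc] zcont]) (use zc in auto)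
    show "?\<gamma> ` {0..T} \<subseteq> M" using \<gamma>(1) chart_onD(1)[OF cc] by blast
  next
    fix d t assume "d \<in> A" "t \<in> {0..T}" "?\<gamma> t \<in> fst d"
    from D[OF this] show "(snd d \<circ> ?\<gamma>) differentiable (at t within {0..T})"
      using differentiableI_vector by blast
  next
    fix d assume d: "d \<in> A"
    define J where "J = {t \<in> {0..T}. ?\<gamma> t \<in> fst d}"
    define S where "S = snd c ` (fst c \<inter> fst d)"
    let ?D = "\<lambda>y. frechet_derivative (transition c d) (at y)"
    have zS: "z ` J \<subseteq> S"
      using \<gamma> unfolding J_def S_def by (force intro: image_eqI)
    have "Ck_on (Suc 0) (transition c d) S"
      using A c d unfolding smooth_atlas_def smooth_on_def S_def by blast
    then have "continuous_on S (\<lambda>y. ?D y b)" for b by simp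
    then have "continuous_on J (\<lambda>t. ?D (z t) b)" for b
      by (rule continuous_on_compose2)
        (use zS zcont in \<open>auto simp: J_def intro: continuous_on_subset\<close>)
    moreover have "continuous_on J z'" using z' by (auto simp: J_def intro: continuous_on_subset)
    ultimately have "continuous_on J (\<lambda>t. \<Sum>b\<in>Basis. (z' t \<bullet> b) *\<^sub>R ?D (z t) b)"
      by (intro continuous_intros)
    moreover have "vector_derivative (snd d \<circ> ?\<gamma>) (at t within {0..T})
        = (\<Sum>b\<in>Basis. (z' t \<bullet> b) *\<^sub>R ?D (z t) b)" if "t \<in> J" for t
    proof -
      have t: "t \<in> {0..T}" "?\<gamma> t \<in> fst d" using that by (auto simp: J_def)
      have "linear (transition_deriv c d (?\<gamma> t))"
        using transition_has_derivative[OF A c d, of "?\<gamma> t"] t \<gamma>(1)[OF t(1)] has_derivative_linear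
        by blast
      then have lin: "linear (?D (z t))"
        using \<gamma>(2)[OF t(1)] by (simp add: transition_deriv_def)
      have "?D (z t) (z' t) = ?D (z t) (\<Sum>b\<in>Basis. (z' t \<bullet> b) *\<^sub>R b)"
        by (simp add: euclidean_representation)
      then show ?thesis
        using V[OF d t] \<gamma>(2)[OF t(1)]
        by (simp add: transition_deriv_def linear_sum[OF lin] linear_cmul[OF lin])
    qed
    ultimately show "continuous_on {t \<in> {0..T}. ?\<gamma> t \<in> fst d}
        (\<lambda>t. vector_derivative (snd d \<circ> ?\<gamma>) (at t within {0..T}))"
      unfolding J_def[symmetric] by (simp cong: continuous_on_cong)
  qed
qed

text \<open>The first time at which the curve is outside the open disc exists since the disc is open in the
  surface. Until then the curve stays in the closed disc, which is closed in the surface, so it is still in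
  the chart at that time.\<close>

lemma first_exit_from_chart_ball:
  fixes M :: "'a::t2_space set" and \<gamma> :: "real \<Rightarrow> 'a"
  assumes c: "chart_on M c" "cball x r \<subseteq> snd c ` fst c"
    and \<gamma>: "continuous_on {0..T} \<gamma>" "\<gamma> ` {0..T} \<subseteq> M" and T: "0 \<le> T"
    and start: "\<gamma> 0 \<in> fst c" "dist (snd c (\<gamma> 0)) x < r"
    and final: "\<not> (\<gamma> T \<in> fst c \<and> dist (snd c (\<gamma> T)) x < r)"
  obtains \<tau> where "0 < \<tau>" "\<tau> \<le> T" "dist (snd c (\<gamma> \<tau>)) x = r"
    "\<And>t. t \<in> {0..\<tau>} \<Longrightarrow> \<gamma> t \<in> fst c \<and> dist (snd c (\<gamma> t)) x \<le> r"
proof -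
  define B where "B = {q \<in> fst c. dist (snd c q) x < r}"
  define K where "K = chart_inv c ` cball x r"
  have K: "q \<in> K \<longleftrightarrow> q \<in> fst c \<and> dist (snd c q) x \<le> r" for q
    unfolding K_def by (rule mem_chart_cball[OF c])
  have "openin (top_of_set {0..T}) ({0..T} \<inter> \<gamma> -` B)"
    using continuous_openin_preimage[OF \<gamma>(1) _ openin_chart_ball[OF c(1)]] \<gamma>(2)
    unfolding B_def by blast
  then have "closedin (top_of_set {0..T}) ({0..T} - ({0..T} \<inter> \<gamma> -` B))"
    by (intro closedin_diff closedin_subtopology_refl[THEN iffD2]) auto
  then have "compact ({0..T} - ({0..T} \<inter> \<gamma> -` B))"
    using closedin_compact compact_Icc by blast
  moreover have "T \<in> {0..T} - ({0..T} \<inter> \<gamma> -` B)" using final T by (auto simp: B_def)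
  ultimately obtain \<tau> where \<tau>: "\<tau> \<in> {0..T} - ({0..T} \<inter> \<gamma> -` B)"
    and min: "\<And>t. t \<in> {0..T} - ({0..T} \<inter> \<gamma> -` B) \<Longrightarrow> \<tau> \<le> t"
    using compact_attains_inf[of "{0..T} - ({0..T} \<inter> \<gamma> -` B)"] by blast
  have before: "\<gamma> t \<in> B" if "0 \<le> t" "t < \<tau>" for t
    using min[of t] that \<tau> by force
  have "\<tau> \<noteq> 0" using \<tau> start by (auto simp: B_def)
  then have \<tau>0: "0 < \<tau>" using \<tau> by auto
  have "closed ({0..T} \<inter> \<gamma> -` K)"
    by (intro continuous_closed_preimage \<gamma>) (auto simp: K_def closed_chart_cball[OF c])
  moreover have "{0..<\<tau>} \<subseteq> {0..T} \<inter> \<gamma> -` K"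
    using before K \<tau> by (fastforce simp: B_def)
  ultimately have "closure {0..<\<tau>} \<subseteq> {0..T} \<inter> \<gamma> -` K" by (rule closure_minimal[rotated])
  then have inK: "\<gamma> t \<in> K" if "t \<in> {0..\<tau>}" for t
    using that \<tau>0 by auto
  show ?thesis
  proof (rule that[OF \<tau>0])
    show "\<tau> \<le> T" using \<tau> by auto
    show "dist (snd c (\<gamma> \<tau>)) x = r"
      using inK[of \<tau>] \<tau> \<tau>0 K by (force simp: B_def)
  qed (use inK K in auto)
qed

section \<open>The critical value and the confinement of orbits\<close>

text \<open>Since \<open>\<bar>\<theta> v\<bar> \<le> \<parallel>v\<parallel>\<close>, the integrand satisfies \<open>L + 1/2 \<ge> (\<parallel>v\<parallel> - 1)\<^sup>2 / 2 \<ge> 0\<close>, so \<open>1/2\<close> is admissible. A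
  contractible unit speed loop running against \<open>\<theta>\<close> where \<open>\<theta>\<close> has norm one has \<open>L = -1/2\<close> throughout, and
  no smaller \<open>k\<close> is admissible. The first bound is assumed for arbitrary families \<open>v\<close> because at the
  break points of a loop the velocity need not be a tangent vector.\<close>

lemma mane_critical_value_eq_half:
  assumes bound: "\<And>q v. (\<theta> q v)\<^sup>2 \<le> g q v v"
    and loop: "T > 0" "closed_contractible_loop M A T \<gamma>"
    and speed: "\<And>t. t \<in> {0..T} \<Longrightarrow> g (\<gamma> t) (velocity A {0..T} \<gamma> t) (velocity A {0..T} \<gamma> t) = 1"
    and anti: "\<And>t. t \<in> {0..T} \<Longrightarrow> \<theta> (\<gamma> t) (velocity A {0..T} \<gamma> t) = - 1"
  shows "mane_critical_value M A (magnetic_lagrangian g \<theta>) = 1/2"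
  unfolding mane_critical_value_def
proof (rule cInf_eq_minimum, goal_cases)
  case 1
  have nonneg: "0 \<le> magnetic_lagrangian g \<theta> q v + 1/2" for q v
  proof -
    have nn: "g q v v \<ge> 0" using bound[of q v] zero_le_power2 order_trans by blast
    have "\<bar>\<theta> q v\<bar> \<le> metric_norm g q v"
      using bound[of q v] real_sqrt_le_mono by (fastforce simp: metric_norm_def)
    moreover have "0 \<le> (metric_norm g q v - 1)\<^sup>2" by simp
    ultimately show ?thesis
      unfolding magnetic_lagrangian_def by (simp add: power2_eq_square algebra_simps)
  qed
  have "0 \<le> integral S (\<lambda>t. magnetic_lagrangian g \<theta> (\<eta> t) (velocity A I \<eta> t) + 1/2)"
    for S I \<eta>
  proof (cases "(\<lambda>t. magnetic_lagrangian g \<theta> (\<eta> t) (velocity A I \<eta> t) + 1/2) integrable_on S")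
    case True
    then show ?thesis by (rule integral_nonneg) (rule nonneg)
  next
    case False
    then show ?thesis unfolding not_integrable_integral[OF False] by simp
  qed
  then show ?case by simp
next
  case (2 k)
  then have "0 \<le> integral {0..T}
      (\<lambda>t. magnetic_lagrangian g \<theta> (\<gamma> t) (velocity A {0..T} \<gamma> t) + k)"
    using loop by blast
  also have "\<dots> = integral {0..T} (\<lambda>t. k - 1/2)"
    by (intro integral_cong) (simp add: magnetic_lagrangian_def metric_norm_def speed anti)
  also have "\<dots> = T * (k - 1/2)" using loop(1) by simp
  finally show ?case using loop(1) by (simp add: zero_le_mult_iff)
qed

text \<open>On the disc of radius \<open>\<rho>\<close> the metric is the Euclidean one times a radial factor, by \<open>isolated\<close>. The
  form is rotationally symmetric and supported in this disc; \<open>bound\<close> says that its norm is at most one and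
  \<open>sharp\<close> that its norm is one on the circle of radius \<open>r0\<close>.\<close>

locale calibrated_disc =
  fixes M :: "'a::t2_space set" and A :: "'a chart set"
    and I :: "('a chart \<times> (real^2) \<times> real) set"
    and c :: "'a chart" and x :: "real^2" and R \<rho> a r0 :: real
  assumes atlas: "smooth_atlas M A" and disc: "chart_disc A c x R"
    and fin: "finite I" and mem: "(c, x, R) \<in> I"
    and isolated: "\<And>d y r q. (d, y, r) \<in> I - {(c, x, R)} \<Longrightarrow> q \<in> fst c \<Longrightarrow>
      dist (snd c q) x \<le> \<rho> \<Longrightarrow> chart_bump d y r q = 0"
    and pos: "0 < a" "0 < r0" "r0 < \<rho>" "\<rho> < R"
    and bound: "\<And>s. s \<ge> 0 \<Longrightarrow> (a * flat_exp 1 (\<rho>\<^sup>2 - s))\<^sup>2 * s \<le> flat_exp 1 (R\<^sup>2 - s)"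
    and sharp: "(a * flat_exp 1 (\<rho>\<^sup>2 - r0\<^sup>2))\<^sup>2 * r0\<^sup>2 = flat_exp 1 (R\<^sup>2 - r0\<^sup>2)"
begin

abbreviation "g \<equiv> bump_metric I"
abbreviation "\<theta> \<equiv> bump_form c x \<rho> a"
abbreviation "L \<equiv> magnetic_lagrangian g \<theta>"

lemma chart_c: "c \<in> A" "chart_on M c"
  using atlas disc by (auto simp: chart_disc_def smooth_atlas_def)

lemma cball_subset: "r \<le> R \<Longrightarrow> cball x r \<subseteq> snd c ` fst c"
  using disc subset_cball[of r R x] by (auto simp: chart_disc_def)

lemma centre: "x \<in> snd c ` fst c" "chart_inv c x \<in> fst c" "snd c (chart_inv c x) = x"
proof -
  show x: "x \<in> snd c ` fst c"
    using disc by (auto simp: chart_disc_def)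
  show "chart_inv c x \<in> fst c" "snd c (chart_inv c x) = x"
    using chart_onD(7,8)[OF chart_c(2) x] by auto
qed

lemma metric_on_disc:
  assumes "q \<in> fst c" "dist (snd c q) x \<le> \<rho>"
  shows "g q v w = flat_exp 1 (R\<^sup>2 - (snd c q - x) \<bullet> (snd c q - x)) * (v c \<bullet> w c)"
proof -
  have "g q v w = (\<Sum>(d, y, r)\<in>{(c, x, R)}. chart_bump d y r q * (v d \<bullet> w d))"
    unfolding bump_metric_def
  proof (intro sum.mono_neutral_right fin ballI)
    fix t assume t: "t \<in> I - {(c, x, R)}"
    obtain d y r where "t = (d, y, r)" by (metis prod_cases3)
    then show "(case t of (d, y, r) \<Rightarrow> chart_bump d y r q * (v d \<bullet> w d)) = 0"
      using isolated[of d y r q] t assms by simp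
  qed (use mem in simp)
  then show ?thesis using assms(1) by (simp add: chart_bump_def)
qed

lemma form_on_disc:
  "q \<in> fst c \<Longrightarrow> \<theta> q v =
    a * flat_exp 1 (\<rho>\<^sup>2 - (snd c q - x) \<bullet> (snd c q - x)) * (rot (snd c q - x) \<bullet> v c)"
  by (simp add: bump_form_def chart_bump_def)

text \<open>The distinguished summand of the metric alone dominates the form, by \<open>bound\<close> and the Cauchy--Schwarz
  inequality.\<close>

lemma form_sq_le_metric: "(\<theta> q v)\<^sup>2 \<le> g q v v"
proof (cases "q \<in> fst c")
  case True
  define y where "y = snd c q - x"
  have "(rot y \<bullet> v c)\<^sup>2 \<le> (y \<bullet> y) * (v c \<bullet> v c)"
    using Cauchy_Schwarz_ineq[of "rot y" "v c"] by simp
  then have "(\<theta> q v)\<^sup>2 \<le> (a * flat_exp 1 (\<rho>\<^sup>2 - y \<bullet> y))\<^sup>2 * ((y \<bullet> y) * (v c \<bullet> v c))"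
    using form_on_disc[OF True] by (simp add: y_def[symmetric] power_mult_distrib mult_left_mono)
  also have "\<dots> \<le> flat_exp 1 (R\<^sup>2 - y \<bullet> y) * (v c \<bullet> v c)"
    using mult_right_mono[OF bound[of "y \<bullet> y"], of "v c \<bullet> v c"] by (simp add: mult.assoc)
  also have "\<dots> = chart_bump c x R q * (v c \<bullet> v c)"
    using True by (simp add: chart_bump_def y_def)
  also have "\<dots> \<le> g q v v" by (rule bump_metric_ge[OF fin mem])
  finally show ?thesis .
next
  case False
  then have "\<theta> q v = 0" by (simp add: bump_form_def chart_bump_def)
  moreover have "0 \<le> g q v v"
    using bump_metric_ge[OF fin mem, of q v] chart_bump_nonneg[of c x R q]
    by (metis inner_ge_zero mult_nonneg_nonneg order_trans)
  ultimately show ?thesis by simp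
qed

text \<open>The extremal loop is the circle of radius \<open>r0\<close>, run clockwise at unit speed: it is contractible
  inside the coordinate disc, and the form takes the value \<open>-1\<close> on its velocity.\<close>

lemma mane_half: "mane_critical_value M A L = 1/2"
proof -
  define W where "W = flat_exp 1 (R\<^sup>2 - r0\<^sup>2)"
  have "r0\<^sup>2 < R\<^sup>2" using pos by (intro power_strict_mono) auto
  then have W: "W > 0" by (simp add: W_def flat_exp_one_pos_iff)
  \<comment> \<open>The angular speed that makes the circle of coordinate radius \<open>r0\<close> have unit speed, as the
    metric is \<open>W\<close> times the Euclidean one there.\<close>
  define \<omega> where "\<omega> = 1 / (r0 * sqrt W)"
  have \<omega>: "\<omega> > 0" using W pos by (simp add: \<omega>_def)
  define T where "T = 2 * pi / \<omega>"
  have T: "T > 0" using \<omega> by (simp add: T_def)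
  have \<omega>T: "\<omega> * T = 2 * pi" using \<omega> by (simp add: T_def)
  define e where "e t = (r0 * cos (\<omega> * t)) *\<^sub>R axis 1 1 + (- r0 * sin (\<omega> * t)) *\<^sub>R (axis 2 1 :: real^2)" for t
  have e_nth: "e t $ 1 = r0 * cos (\<omega> * t)" "e t $ 2 = - r0 * sin (\<omega> * t)" for t
    by (simp_all add: e_def axis_def)
  have e_sq: "e t \<bullet> e t = r0\<^sup>2" for t
  proof -
    have "e t \<bullet> e t = (r0 * cos (\<omega> * t))\<^sup>2 + (r0 * sin (\<omega> * t))\<^sup>2"
      unfolding inner_real2 e_nth by (simp add: power2_eq_square)
    also have "\<dots> = r0\<^sup>2 * ((cos (\<omega> * t))\<^sup>2 + (sin (\<omega> * t))\<^sup>2)"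
      by (simp only: power_mult_distrib distrib_left)
    finally show ?thesis by simp
  qed
  then have e_norm: "norm (e t) = r0" for t using pos by (simp add: norm_eq_sqrt_inner)
  have e_deriv: "(e has_vector_derivative (- \<omega>) *\<^sub>R rot (e t)) (at t within S)" for t S
  proof -
    have "(e has_vector_derivative (- r0 * \<omega> * sin (\<omega> * t)) *\<^sub>R axis 1 1
        + (- r0 * \<omega> * cos (\<omega> * t)) *\<^sub>R axis 2 1) (at t within S)"
      unfolding e_def
      by (auto intro!: derivative_eq_intros simp: mult_ac
          simp flip: has_real_derivative_iff_has_vector_derivative)
    moreover have "(- r0 * \<omega> * sin (\<omega> * t)) *\<^sub>R axis 1 1 + (- r0 * \<omega> * cos (\<omega> * t)) *\<^sub>R axis 2 1
        = (- \<omega>) *\<^sub>R rot (e t)"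
      by (simp add: vec_eq_iff forall_2 e_nth axis_def)
    ultimately show ?thesis by simp
  qed
  have e_cont: "continuous_on S e" for S unfolding e_def by (intro continuous_intros)
  define z where "z t = x + e t" for t
  have z: "(z has_vector_derivative (- \<omega>) *\<^sub>R rot (e t)) (at t within S)" for t S
    unfolding z_def using has_vector_derivative_add[OF has_vector_derivative_const e_deriv] by simp
  have zin: "z t \<in> cball x \<rho>" for t using e_norm pos by (simp add: z_def dist_norm)
  then have zc: "z t \<in> snd c ` fst c" for t using cball_subset[of \<rho>] pos by auto
  define \<gamma> where "\<gamma> = chart_inv c \<circ> z"
  have \<gamma>: "\<gamma> t \<in> fst c" "snd c (\<gamma> t) = z t" for t
    using zc chart_onD(7,8)[OF chart_c(2)] by (auto simp: \<gamma>_def)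
  have z'cont: "continuous_on {0..T} (\<lambda>t. (- \<omega>) *\<^sub>R rot (e t))"
    by (intro continuous_intros bounded_linear.continuous_on[OF bounded_linear_rot] e_cont)
  have C1: "C1_curve M A {0..T} \<gamma>"
    and vel: "t \<in> {0..T} \<Longrightarrow> velocity A {0..T} \<gamma> t c = (- \<omega>) *\<^sub>R rot (e t)" for t
    unfolding \<gamma>_def by (rule C1_curve_in_chart[OF atlas chart_c(1) T z z'cont zc], assumption?)+
  have "homotopic_loops (cball x \<rho>) (\<lambda>s. z (T * s)) (\<lambda>s. x)"
  proof (rule homotopic_loops_linear)
    show "path (\<lambda>s. z (T * s))"
      unfolding path_def z_def
      by (intro continuous_intros continuous_on_compose2[OF e_cont[of UNIV]]) auto
    show "closed_segment (z (T * s)) x \<subseteq> cball x \<rho>" for s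
      using zin pos by (intro closed_segment_subset) auto
  qed (use \<omega>T in \<open>auto simp: path_def pathfinish_def pathstart_def z_def e_def\<close>)
  then have "homotopic_loops M (chart_inv c \<circ> (\<lambda>s. z (T * s))) (chart_inv c \<circ> (\<lambda>s. x))"
  proof (rule homotopic_loops_continuous_image)
    show "continuous_on (cball x \<rho>) (chart_inv c)"
      using chart_onD(5)[OF chart_c(2)] cball_subset[of \<rho>] pos continuous_on_subset by auto
    show "chart_inv c \<in> cball x \<rho> \<rightarrow> M"
      using chart_onD(1,7)[OF chart_c(2)] cball_subset[of \<rho>] pos by force
  qed
  then have hom: "homotopic_loops M (\<lambda>s. \<gamma> (T * s)) (\<lambda>s. chart_inv c x)"
    by (simp add: \<gamma>_def comp_def)
  have xM: "chart_inv c x \<in> M"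
    using chart_onD(1)[OF chart_c(2)] centre(2) by blast
  have "piecewise_C1_curve M A T \<gamma>"
    unfolding piecewise_C1_curve_def
    using T C1 by (intro exI[of _ 1] exI[of _ "\<lambda>i. if i = 0 then 0 else T"]) auto
  moreover have "\<gamma> 0 = \<gamma> T" using \<omega>T by (simp add: \<gamma>_def z_def e_def)
  ultimately have loop: "closed_contractible_loop M A T \<gamma>"
    unfolding closed_contractible_loop_def using hom xM by blast
  have ze: "snd c (\<gamma> t) - x = e t" for t by (simp add: \<gamma> z_def)
  have "r0 * (a * flat_exp 1 (\<rho>\<^sup>2 - r0\<^sup>2)) = sqrt W"
    using sharp pos flat_exp_one_nonneg[of "\<rho>\<^sup>2 - r0\<^sup>2"]
    by (intro real_sqrt_unique[symmetric]) (auto simp: W_def power_mult_distrib mult_ac)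
  then have F: "\<omega> * (a * flat_exp 1 (\<rho>\<^sup>2 - r0\<^sup>2)) * r0\<^sup>2 = 1"
    using pos W by (simp add: \<omega>_def power2_eq_square field_simps)
  have W1: "W * \<omega>\<^sup>2 * r0\<^sup>2 = 1"
    using pos W by (simp add: \<omega>_def power_divide power_mult_distrib)
  show ?thesis
  proof (rule mane_critical_value_eq_half[OF form_sq_le_metric T loop])
    fix t assume t: "t \<in> {0..T}"
    have d: "dist (snd c (\<gamma> t)) x \<le> \<rho>" using zin[of t] by (simp add: \<gamma> dist_commute)
    show "g (\<gamma> t) (velocity A {0..T} \<gamma> t) (velocity A {0..T} \<gamma> t) = 1"
      using W1 by (simp add: metric_on_disc[OF \<gamma>(1) d] ze e_sq vel[OF t]
          W_def[symmetric]) (simp add: power2_eq_square mult_ac)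
    show "\<theta> (\<gamma> t) (velocity A {0..T} \<gamma> t) = - 1"
      using F by (simp add: form_on_disc[OF \<gamma>(1)] ze e_sq vel[OF t] mult_ac)
  qed
qed

lemma local_lagrangian_on_disc:
  assumes "y \<in> ball x \<rho>"
  shows "local_lagrangian A L c y u =
    1/2 * flat_exp 1 (R\<^sup>2 - (y - x) \<bullet> (y - x)) * (u \<bullet> u) +
    a * flat_exp 1 (\<rho>\<^sup>2 - (y - x) \<bullet> (y - x)) * (rot (y - x) \<bullet> u)"
proof -
  have y: "y \<in> snd c ` fst c" using assms cball_subset[of \<rho>] pos by auto
  define q where "q = chart_inv c y"
  have q: "q \<in> fst c" "snd c q = y"
    using chart_onD(7,8)[OF chart_c(2) y] by (auto simp: q_def)
  have d: "dist (snd c q) x \<le> \<rho>" using assms q by (simp add: dist_commute)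
  have v: "tangent_of A c q u c = u"
    using q chart_c transition_deriv_refl by (simp add: tangent_of_def)
  have "g q w w \<ge> 0" for w
    using form_sq_le_metric[of q w] zero_le_power2 order_trans by blast
  then show ?thesis
    unfolding local_lagrangian_def magnetic_lagrangian_def metric_norm_def q_def[symmetric]
    by (simp add: metric_on_disc[OF q(1) d] form_on_disc[OF q(1)] v q(2))
qed

text \<open>The momentum of the Lagrangian, as a vector of the plane.\<close>

lemma fibre_derivative:
  assumes "y \<in> ball x \<rho>"
  shows "frechet_derivative (local_lagrangian A L c y) (at u) w =
    (flat_exp 1 (R\<^sup>2 - (y - x) \<bullet> (y - x)) *\<^sub>R u +
     (a * flat_exp 1 (\<rho>\<^sup>2 - (y - x) \<bullet> (y - x))) *\<^sub>R rot (y - x)) \<bullet> w"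
proof -
  define W F where "W = flat_exp 1 (R\<^sup>2 - (y - x) \<bullet> (y - x))"
    and "F = a * flat_exp 1 (\<rho>\<^sup>2 - (y - x) \<bullet> (y - x))"
  have "((\<lambda>u. 1/2 * W * (u \<bullet> u) + F * (rot (y - x) \<bullet> u)) has_derivative
      (\<lambda>w. (W *\<^sub>R u + F *\<^sub>R rot (y - x)) \<bullet> w)) (at u)"
    by (auto intro!: derivative_eq_intros simp: fun_eq_iff inner_add_left inner_commute algebra_simps)
  moreover have "local_lagrangian A L c y = (\<lambda>u. 1/2 * W * (u \<bullet> u) + F * (rot (y - x) \<bullet> u))"
    by (simp add: fun_eq_iff local_lagrangian_on_disc[OF assms] W_def F_def)
  ultimately show ?thesis
    by (simp add: W_def F_def flip: frechet_derivative_at)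
qed

text \<open>The position enters through radial functions, which contribute multiples of \<open>y - x\<close>, and through
  the factor \<open>rot (y - x)\<close>, which contributes the magnetic term. In the rotation direction
  \<open>rot (y - x)\<close>, orthogonal to \<open>y - x\<close>, only the magnetic term is felt, whatever \<open>\<kappa>\<close> is.\<close>

lemma base_derivative:
  assumes "y \<in> ball x \<rho>"
  obtains \<kappa> where "\<And>w. frechet_derivative (\<lambda>y. local_lagrangian A L c y u) (at y) w =
    (\<kappa> *\<^sub>R (y - x) - (a * flat_exp 1 (\<rho>\<^sup>2 - (y - x) \<bullet> (y - x))) *\<^sub>R rot u) \<bullet> w"
proof -
  define h' where "h' = flat_exp (monom 1 2 * (1 - pderiv 1))"
  have h: "((\<lambda>y. flat_exp 1 (b - (y - x) \<bullet> (y - x))) has_derivative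
      (\<lambda>w. h' (b - (y - x) \<bullet> (y - x)) * (- 2 * ((y - x) \<bullet> w)))) (at y)" for b
  proof -
    have "((\<lambda>y. b - (y - x) \<bullet> (y - x)) has_derivative (\<lambda>w. - 2 * ((y - x) \<bullet> w))) (at y)"
      by (auto intro!: derivative_eq_intros simp: fun_eq_iff inner_commute)
    from has_derivative_compose[OF this
        flat_exp_deriv[of 1, THEN has_field_derivative_imp_has_derivative]]
    show ?thesis by (simp add: h'_def)
  qed
  define F where "F = a * flat_exp 1 (\<rho>\<^sup>2 - (y - x) \<bullet> (y - x))"
  define \<kappa> where "\<kappa> = - h' (R\<^sup>2 - (y - x) \<bullet> (y - x)) * (u \<bullet> u)
      - 2 * a * h' (\<rho>\<^sup>2 - (y - x) \<bullet> (y - x)) * (rot (y - x) \<bullet> u)"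
  have r: "((\<lambda>y. rot (y - x) \<bullet> u) has_derivative (\<lambda>w. - (rot u \<bullet> w))) (at y)"
  proof -
    have "((\<lambda>y. y - x) has_derivative (\<lambda>w. w)) (at y)"
      by (auto intro!: derivative_eq_intros)
    then have "((\<lambda>y. rot (y - x) \<bullet> u) has_derivative (\<lambda>w. rot w \<bullet> u)) (at y)"
      by (intro has_derivative_inner_left bounded_linear.has_derivative[OF bounded_linear_rot])
    moreover have "rot w \<bullet> u = - (rot u \<bullet> w)" for w by (simp add: inner_real2)
    ultimately show ?thesis by simp
  qed
  have "((\<lambda>y. 1/2 * flat_exp 1 (R\<^sup>2 - (y - x) \<bullet> (y - x)) * (u \<bullet> u) +
      a * flat_exp 1 (\<rho>\<^sup>2 - (y - x) \<bullet> (y - x)) * (rot (y - x) \<bullet> u)) has_derivative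
      (\<lambda>w. (\<kappa> *\<^sub>R (y - x) - F *\<^sub>R rot u) \<bullet> w)) (at y)"
    by (rule h r derivative_eq_intros refl)+
      (simp add: fun_eq_iff \<kappa>_def F_def inner_diff_left algebra_simps)
  then have "((\<lambda>y. local_lagrangian A L c y u) has_derivative
      (\<lambda>w. (\<kappa> *\<^sub>R (y - x) - F *\<^sub>R rot u) \<bullet> w)) (at y)"
    by (rule has_derivative_transform_within_open[OF _ open_ball assms])
      (simp add: local_lagrangian_on_disc)
  then have "frechet_derivative (\<lambda>y. local_lagrangian A L c y u) (at y) w =
      (\<kappa> *\<^sub>R (y - x) - F *\<^sub>R rot u) \<bullet> w" for w
    by (simp flip: frechet_derivative_at)
  then show ?thesis using that unfolding F_def by blast
qed

text \<open>Rotational symmetry makes the angular momentum \<open>Q\<close>, the momentum paired with the rotation field,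
  constant along the orbit, by Noether's theorem. It vanishes at the centre, where the rotation field does.
  So on the circle of radius \<open>r0\<close> the velocity paired with the rotation field in the metric is the
  negative of the form on the rotation field. There the form has norm one and attains it in this
  direction, so the speed is at least one by the Cauchy--Schwarz inequality.\<close>

lemma orbit_from_centre_energy:
  assumes EL: "EL_solution M A L T \<gamma>" and T: "T > 0"
    and start: "\<gamma> 0 = chart_inv c x"
    and \<tau>: "0 < \<tau>" "\<tau> \<le> T" "dist (snd c (\<gamma> \<tau>)) x = r0"
    and inside: "\<And>t. t \<in> {0..\<tau>} \<Longrightarrow> \<gamma> t \<in> fst c \<and> dist (snd c (\<gamma> t)) x \<le> r0"
  shows "1/2 \<le> energy g (\<gamma> \<tau>) (velocity A {0..T} \<gamma> \<tau>)"
proof -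
  define \<xi> where "\<xi> = snd c \<circ> \<gamma>"
  define u where "u t = velocity A {0..T} \<gamma> t c" for t
  define P where "P w s = frechet_derivative (local_lagrangian A L c (\<xi> s)) (at (u s)) w" for w s
  define X where "X t w = frechet_derivative (\<lambda>y. local_lagrangian A L c y (u t)) (at (\<xi> t)) w" for t w
  define J where "J s = rot (\<xi> s - x)" for s
  define F where "F t = a * flat_exp 1 (\<rho>\<^sup>2 - (\<xi> t - x) \<bullet> (\<xi> t - x))" for t
  define W where "W t = flat_exp 1 (R\<^sup>2 - (\<xi> t - x) \<bullet> (\<xi> t - x))" for t
  define Q where "Q s = P (axis 1 1) s * J s $ 1 + P (axis 2 1) s * J s $ 2" for s
  have tin: "t \<in> {0..T}" "\<gamma> t \<in> fst c" "\<xi> t \<in> ball x \<rho>" if "t \<in> {0..\<tau>}" for t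
    using inside[OF that] that \<tau> pos by (auto simp: \<xi>_def dist_commute)
  have P: "P w t = (W t *\<^sub>R u t + F t *\<^sub>R J t) \<bullet> w" if "t \<in> {0..\<tau>}" for w t
    unfolding P_def W_def F_def J_def by (rule fibre_derivative[OF tin(3)[OF that]])
  have Q: "Q t = (W t *\<^sub>R u t + F t *\<^sub>R J t) \<bullet> J t" if "t \<in> {0..\<tau>}" for t
    unfolding Q_def P[OF that] by (simp add: axis_def inner_real2 algebra_simps)
  have "(Q has_real_derivative 0) (at t within {0..\<tau>})" if t: "t \<in> {0..\<tau>}" for t
  proof -
    have sub: "{0..\<tau>} \<subseteq> {0..T}" using \<tau> by auto
    have dP: "(P w has_real_derivative X t w) (at t within {0..T})" for w
      using EL tin[OF t] chart_c(1) unfolding EL_solution_def Let_def P_def X_def u_def \<xi>_def by blast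
    have "\<xi> differentiable (at t within {0..T})"
      using EL tin[OF t] chart_c(1) unfolding EL_solution_def C1_curve_def \<xi>_def by blast
    then have "(\<xi> has_vector_derivative u t) (at t within {0..T})"
      using tin[OF t] chart_c(1) by (simp add: u_def velocity_def \<xi>_def vector_derivative_works)
    then have "(J has_vector_derivative rot (u t)) (at t within {0..T})"
      unfolding J_def
      by (intro bounded_linear.has_vector_derivative[OF bounded_linear_rot])
        (auto intro!: derivative_eq_intros)
    then have dJ: "((\<lambda>s. J s $ i) has_real_derivative rot (u t) $ i) (at t within {0..T})" for i
      unfolding has_real_derivative_iff_has_vector_derivative
      by (rule bounded_linear.has_vector_derivative[OF bounded_linear_vec_nth])
    obtain \<kappa> where X: "\<And>w. X t w = (\<kappa> *\<^sub>R (\<xi> t - x) - F t *\<^sub>R rot (u t)) \<bullet> w"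
      unfolding X_def F_def using base_derivative[OF tin(3)[OF t], of "u t"] by metis
    have "(Q has_real_derivative (X t (axis 1 1) * J t $ 1 + P (axis 1 1) t * rot (u t) $ 1)
        + (X t (axis 2 1) * J t $ 2 + P (axis 2 1) t * rot (u t) $ 2)) (at t within {0..T})"
      unfolding Q_def by (rule derivative_eq_intros dP dJ refl)+ simp
    \<comment> \<open>The force \<open>X\<close> along \<open>J\<close> is \<open>- F (u \<bullet> (\<xi> - x))\<close>, as \<open>\<xi> - x\<close> and \<open>J\<close> are orthogonal; the momentum along
      \<open>rot u\<close> is \<open>F (u \<bullet> (\<xi> - x))\<close>, as \<open>u\<close> and \<open>rot u\<close> are orthogonal.\<close>
    moreover have "(X t (axis 1 1) * J t $ 1 + P (axis 1 1) t * rot (u t) $ 1)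
        + (X t (axis 2 1) * J t $ 2 + P (axis 2 1) t * rot (u t) $ 2) = 0"
      unfolding X P[OF t] J_def by (simp add: inner_real2 axis_def algebra_simps)
    ultimately show ?thesis using has_field_derivative_subset[OF _ sub] by simp
  qed
  then have "\<exists>k. \<forall>t\<in>{0..\<tau>}. Q t = k"
    by (intro has_field_derivative_zero_constant) auto
  then have "Q \<tau> = Q 0" using \<tau> by auto
  moreover have "J 0 = 0"
    by (simp add: J_def \<xi>_def start centre(3) vec_eq_iff forall_2)
  ultimately have "(W \<tau> *\<^sub>R u \<tau> + F \<tau> *\<^sub>R J \<tau>) \<bullet> J \<tau> = 0"
    using Q[of \<tau>] Q[of 0] \<tau> by simp
  have r0: "(\<xi> \<tau> - x) \<bullet> (\<xi> \<tau> - x) = r0\<^sup>2"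
    using \<tau>(3) by (simp add: \<xi>_def dist_norm dot_square_norm)
  have JJ: "J \<tau> \<bullet> J \<tau> = r0\<^sup>2" by (simp add: J_def r0)
  have "W \<tau> * (u \<tau> \<bullet> J \<tau>) = - F \<tau> * r0\<^sup>2"
    using \<open>(W \<tau> *\<^sub>R u \<tau> + F \<tau> *\<^sub>R J \<tau>) \<bullet> J \<tau> = 0\<close> by (simp add: inner_add_left JJ)
  then have "(F \<tau> * r0\<^sup>2)\<^sup>2 = (W \<tau>)\<^sup>2 * (u \<tau> \<bullet> J \<tau>)\<^sup>2"
    by (simp flip: power_mult_distrib)
  also have "\<dots> \<le> (W \<tau>)\<^sup>2 * ((u \<tau> \<bullet> u \<tau>) * r0\<^sup>2)"
    using Cauchy_Schwarz_ineq[of "u \<tau>" "J \<tau>"] JJ by (simp add: mult_left_mono)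
  finally have 1: "(F \<tau> * r0\<^sup>2)\<^sup>2 \<le> (W \<tau>)\<^sup>2 * ((u \<tau> \<bullet> u \<tau>) * r0\<^sup>2)" .
  have "r0\<^sup>2 < R\<^sup>2" using pos by (intro power_strict_mono) auto
  then have Wpos: "W \<tau> > 0" by (simp add: W_def r0 flat_exp_one_pos_iff)
  have "W \<tau> * r0\<^sup>2 * 1 = (F \<tau> * r0\<^sup>2)\<^sup>2"
    using sharp by (simp add: F_def W_def r0 power_mult_distrib power2_eq_square mult_ac)
  also note 1
  also have "(W \<tau>)\<^sup>2 * ((u \<tau> \<bullet> u \<tau>) * r0\<^sup>2) = W \<tau> * r0\<^sup>2 * (W \<tau> * (u \<tau> \<bullet> u \<tau>))"
    by (simp add: power2_eq_square mult_ac)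
  finally have "1 \<le> W \<tau> * (u \<tau> \<bullet> u \<tau>)"
    using Wpos pos by (subst (asm) mult_le_cancel_left_pos) auto
  moreover have "g (\<gamma> \<tau>) (velocity A {0..T} \<gamma> \<tau>) (velocity A {0..T} \<gamma> \<tau>) = W \<tau> * (u \<tau> \<bullet> u \<tau>)"
    using metric_on_disc[of "\<gamma> \<tau>"] inside[of \<tau>] \<tau> pos by (simp add: W_def u_def \<xi>_def)
  ultimately show ?thesis by (simp add: energy_def metric_norm_def)
qed

text \<open>An orbit that leaves the disc of radius \<open>r0\<close> crosses its boundary circle, where its energy is at least
  \<open>1/2\<close>; but the energy is constant.\<close>

lemma no_orbit:
  assumes k: "k < 1/2" and q1: "\<not> (q1 \<in> fst c \<and> dist (snd c q1) x < r0)"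
  shows "\<not> carries_EL_orbit M A L (energy g) k (chart_inv c x) q1"
proof
  assume "carries_EL_orbit M A L (energy g) k (chart_inv c x) q1"
  then obtain T \<gamma> where T: "T > 0" and EL: "EL_solution M A L T \<gamma>"
    and ends: "\<gamma> 0 = chart_inv c x" "\<gamma> T = q1"
    and energy: "\<And>t. t \<in> {0..T} \<Longrightarrow> energy g (\<gamma> t) (velocity A {0..T} \<gamma> t) = k"
    unfolding carries_EL_orbit_def by blast
  have cont: "continuous_on {0..T} \<gamma>" "\<gamma> ` {0..T} \<subseteq> M"
    using EL by (auto simp: EL_solution_def C1_curve_def)
  have start: "\<gamma> 0 \<in> fst c" "dist (snd c (\<gamma> 0)) x < r0"
    using ends pos centre by simp_all
  have final: "\<not> (\<gamma> T \<in> fst c \<and> dist (snd c (\<gamma> T)) x < r0)"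
    unfolding ends by (rule q1)
  have sub: "cball x r0 \<subseteq> snd c ` fst c"
    using cball_subset[of r0] pos by linarith
  obtain \<tau> where \<tau>: "0 < \<tau>" "\<tau> \<le> T" "dist (snd c (\<gamma> \<tau>)) x = r0"
    "\<And>t. t \<in> {0..\<tau>} \<Longrightarrow> \<gamma> t \<in> fst c \<and> dist (snd c (\<gamma> t)) x \<le> r0"
    using first_exit_from_chart_ball[OF chart_c(2) sub cont less_imp_le[OF T] start final] by blast
  have "1/2 \<le> energy g (\<gamma> \<tau>) (velocity A {0..T} \<gamma> \<tau>)"
    by (rule orbit_from_centre_energy[OF EL T ends(1) \<tau>])
  then show False using energy[of \<tau>] \<tau> k by auto
qed

end

section \<open>The theorem\<close>

theorem lemma4p3p1:
  fixes M :: "'a::t2_space set" and A :: "'a chart set" and \<epsilon> :: real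
  assumes "closed_connected_surface M A" and "orientable M A" and "\<epsilon> > 0"
  shows "\<exists>g \<theta>. riemannian_metric M A g \<and> smooth_one_form M A \<theta> \<and>
    mane_critical_value M A (magnetic_lagrangian g \<theta>) \<in> {1/2 - \<epsilon>..1/2} \<and>
    (\<exists>q0\<in>M. \<exists>q1\<in>M. q0 \<noteq> q1 \<and>
      (\<forall>k<1/2 - \<epsilon>. \<not> carries_EL_orbit M A (magnetic_lagrangian g \<theta>) (energy g) k q0 q1))"
proof -
  have atlas: "smooth_atlas M A" and M: "compact M" "M \<noteq> {}"
    using assms(1) by (auto simp: closed_connected_surface_def)
  obtain p c where c: "c \<in> A" "p \<in> fst c"
    using atlas M(2) unfolding smooth_atlas_def by blast
  then have cc: "chart_on M c" using atlas by (simp add: smooth_atlas_def)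
  define x where "x = snd c p"
  obtain R where R: "R > 0" "cball x R \<subseteq> snd c ` fst c"
    using chart_onD(3)[OF cc] c(2) unfolding x_def open_contains_cball by blast
  then have disc: "chart_disc A c x R" using c by (simp add: chart_disc_def)
  define \<rho> where "\<rho> = R / 2"
  have \<rho>: "0 < \<rho>" "\<rho> < R" using R by (auto simp: \<rho>_def)
  obtain I where I: "finite I" "(c, x, R) \<in> I" "\<And>c x r. (c, x, r) \<in> I \<Longrightarrow> chart_disc A c x r"
    "\<And>q. q \<in> M \<Longrightarrow> \<exists>(c, x, r)\<in>I. chart_bump c x r q > 0"
    "\<And>d y r q. (d, y, r) \<in> I - {(c, x, R)} \<Longrightarrow> q \<in> fst c \<Longrightarrow> dist (snd c q) x \<le> \<rho>
      \<Longrightarrow> chart_bump d y r q = 0"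
    using exists_bump_cover[OF atlas M(1) disc \<rho>(2)] by metis
  obtain a r0 where a: "a > 0" "0 < r0" "r0 < \<rho>"
    "\<And>s. s \<ge> 0 \<Longrightarrow> (a * flat_exp 1 (\<rho>\<^sup>2 - s))\<^sup>2 * s \<le> flat_exp 1 (R\<^sup>2 - s)"
    "(a * flat_exp 1 (\<rho>\<^sup>2 - r0\<^sup>2))\<^sup>2 * r0\<^sup>2 = flat_exp 1 (R\<^sup>2 - r0\<^sup>2)"
    using exists_calibration[OF \<rho>] by metis
  interpret calibrated_disc M A I c x R \<rho> a r0
    by unfold_locales (use atlas disc I a \<rho> in auto)
  define q1 where "q1 = chart_inv c (x + r0 *\<^sub>R axis 1 1)"
  have "x + r0 *\<^sub>R axis 1 1 \<in> cball x R" using a \<rho> by (simp add: dist_norm)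
  then have "x + r0 *\<^sub>R axis 1 1 \<in> snd c ` fst c" using R(2) by blast
  then have q1: "q1 \<in> fst c" "snd c q1 = x + r0 *\<^sub>R axis 1 1"
    using chart_onD(7,8)[OF cc] by (auto simp: q1_def)
  then have d: "dist (snd c q1) x = r0" using a by (simp add: dist_norm)
  have p: "chart_inv c x = p" using chart_onD(6)[OF cc c(2)] by (simp add: x_def)
  have "p \<noteq> q1" using d a by (auto simp: x_def)
  moreover have "p \<in> M" "q1 \<in> M" using c q1 chart_onD(1)[OF cc] by auto
  moreover have "\<not> carries_EL_orbit M A L (energy g) k p q1" if "k < 1/2 - \<epsilon>" for k
    using no_orbit[of k q1] that assms(3) d p by simp
  moreover have "mane_critical_value M A L \<in> {1/2 - \<epsilon>..1/2}"
    using mane_half assms(3) by simp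
  moreover have "smooth_one_form M A \<theta>"
    by (rule smooth_bump_form[OF atlas]) (use disc \<rho> cball_subset[of \<rho>] in \<open>auto simp: chart_disc_def\<close>)
  ultimately show ?thesis
    using riemannian_bump_metric[OF atlas I(1,3,4)] by blast
qed

end
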